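(* Suppose that $B$ is $E$-visible finite, let $0\neq\mathbf m\in\mathbb Z_{\ge0}^t$ and let $1\le\ell\le h(\mathbf m)$ be an integer. Then the following hold. (1) If $\mathcal L(\mathbf m,\ell)\neq\varnothing$, then $r(\mathbf m)-1\le \ell\,(h(\mathbf m)-\ell)$. (2) The subset $\mathcal L(\mathbf m,\ell)\subseteq \mathrm{Gr}_\ell(\mathrm{Hom}_B(E,N_{\mathbf m}))$ is Zariski-open. (3) The isomorphism classes of mixed bricks $M=(N,W,\eta)$ in $\mathrm{mod}\,\Lambda$, $\Lambda=B[E]$, satisfying $N\cong N_{\mathbf m}$ and $\dim_\Bbbk W=\ell$ are in bijection with the $\mathrm{Aut}_B(N_{\mathbf m})$-orbits in $\mathcal L(\mathbf m,\ell)$.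
   Context: $\Bbbk$ is an algebraically closed field; all algebras are finite-dimensional over $\Bbbk$ and all modules are finite-dimensional right modules. $B$ is a $\Bbbk$-algebra, $E$ is a $\Bbbk$-$B$-bimodule (i.e. a right $B$-module), and $\Lambda=B[E]=\begin{pmatrix} B & 0 \\ E & \Bbbk \end{pmatrix}$ is the one-point extension. Right $\Lambda$-modules are described by triples $(N,W,\eta)$ with $N$ a right $B$-module, $W$ a finite-dimensional $\Bbbk$-vector space and $\eta\colon W\to \mathrm{Hom}_B(E,N)$ a $\Bbbk$-linear map; a morphism $(N,W,\eta)\to(N',W',\eta')$ is a pair $(f,g)$ with $f\colon N\to N'$ $B$-linear, $g\colon W\to W'$ $\Bbbk$-linear and $f_*\circ\eta=\eta'\circ g$, where $f_*(\varphi)=f\circ\varphi$. A brick is a module whose endomorphism algebra is $\Bbbk\,\mathrm{id}$ (equivalently a division algebra). A mixed brick is a brick $(N,W,\eta)$ with $N\ne0$ and $W\neq0$. An indecomposable $B$-module $X$ is $E$-visible if $\mathrm{Hom}_B(E,X)\neq0$; $B$ is $E$-visible finite if there are only finitely many isomorphism classes of $E$-visible indecomposable $B$-modules. In that case let $X_1,\dots,X_t$ be a complete list of representatives of these classes. For $\mathbf m=(m_1,\dots,m_t)\in\mathbb Z_{\ge0}^t$ put $N_{\mathbf m}=\bigoplus_{i=1}^tX_i^{m_i}$, $h(\mathbf m)=\dim_\Bbbk\mathrm{Hom}_B(E,N_{\mathbf m})$, $r(\mathbf m)=\dim_\Bbbk\mathrm{End}_B(N_{\mathbf m})$. $\mathrm{Gr}_\ell(V)$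 is the Grassmannian of $\ell$-dimensional subspaces of $V$, a projective variety with its Zariski topology. For $L\in\mathrm{Gr}_\ell(\mathrm{Hom}_B(E,N_{\mathbf m}))$ set $\mathrm{Stab}_{\mathrm{End}_B(N_{\mathbf m})}(L)=\{f\in\mathrm{End}_B(N_{\mathbf m})\mid f_*(L)\subseteq L\}$, and $$\mathcal L(\mathbf m,\ell)=\{L\in\mathrm{Gr}_\ell(\mathrm{Hom}_B(E,N_{\mathbf m}))\mid \mathrm{Stab}_{\mathrm{End}_B(N_{\mathbf m})}(L)=\Bbbk\,\mathrm{id}_{N_{\mathbf m}}\}.$$ The group $\mathrm{Aut}_B(N_{\mathbf m})$ acts on the Grassmannian, and on $\mathcal L(\mathbf m,\ell)$, by $f\cdot L=f_*(L)$. *)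

theory Defs
  imports
    "HOL-Analysis.Abstract_Topology"
    "HOL-Computational_Algebra.Polynomial"
    "HOL-Library.Function_Algebras"
    "HOL-Library.Nat_Bijection"
    "Jordan_Normal_Form.Determinant"
    "Jordan_Normal_Form.DL_Submatrix"
begin

section \<open>Grassmannians and their Zariski topology\<close>

text \<open>
  Homogeneous polynomial functions of a given degree in coordinates indexed by \<open>K\<close>.  Over an infinite
  field (in particular over an algebraically closed one) they correspond to homogeneous polynomials.
\<close>

inductive hom_poly :: "'i set \<Rightarrow> nat \<Rightarrow> (('i \<Rightarrow> 'k::field) \<Rightarrow> 'k) \<Rightarrow> bool" for K where
  const: "hom_poly K 0 (\<lambda>p. c)"
| var: "i \<in> K \<Longrightarrow> hom_poly K 1 (\<lambda>p. p i)"
| add: "hom_poly K d F \<Longrightarrow> hom_poly K d G \<Longrightarrow> hom_poly K d (\<lambda>p. F p + G p)"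
| mult: "hom_poly K d F \<Longrightarrow> hom_poly K e G \<Longrightarrow> hom_poly K (d + e) (\<lambda>p. F p * G p)"

lemma hom_poly_scale:
  "hom_poly K d F \<Longrightarrow> F (\<lambda>i. c * p i) = c ^ d * F p"
  by (induction rule: hom_poly.induct) (auto simp: power_add algebra_simps)

context vector_space
begin

(* The prefix local. is needed because each definition is also interpreted, unqualified, for real
   vector spaces. *)

text \<open>Finite-dimensional subspaces; note that \<open>dim\<close> alone is \<open>0\<close> on infinite-dimensional ones.\<close>

definition fd_subspace :: "'b set \<Rightarrow> bool" where
  "fd_subspace V \<longleftrightarrow> (\<exists>S. finite S \<and> span S = V)"

definition grassmannian :: "'b set \<Rightarrow> nat \<Rightarrow> 'b set set" where
  "grassmannian V l = {L. local.fd_subspace L \<and> L \<subseteq> V \<and> dim L = l}"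

definition ordered_basis :: "'b list \<Rightarrow> 'b set \<Rightarrow> bool" where
  "ordered_basis bs V \<longleftrightarrow> distinct bs \<and> independent (set bs) \<and> span (set bs) = V"

definition row_vec :: "'b list \<Rightarrow> 'a mat \<Rightarrow> nat \<Rightarrow> 'b" where
  "row_vec bs A a = (\<Sum>j<length bs. A $$ (a, j) *s bs ! j)"

text \<open>
  Homogeneous Pluecker coordinate vectors of an \<open>l\<close>-dimensional subspace \<open>L\<close> with respect to an
  ordered basis \<open>bs\<close> of the ambient space: the maximal minors of all matrices whose rows are
  the coordinates of vectors spanning \<open>L\<close>.  The minor at \<open>I\<close> uses the columns in \<open>I\<close>.
\<close>

definition plucker_index :: "'b list \<Rightarrow> nat \<Rightarrow> nat set set" where
  "plucker_index bs l = {I. I \<subseteq> {..<length bs} \<and> card I = l}"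

definition plucker :: "'b list \<Rightarrow> nat \<Rightarrow> 'b set \<Rightarrow> (nat set \<Rightarrow> 'a) set" where
  "plucker bs l L =
    {(\<lambda>I. if I \<in> local.plucker_index bs l then det (submatrix A UNIV I) else 0) | A.
       A \<in> carrier_mat l (length bs) \<and> span (local.row_vec bs A ` {..<l}) = L}"

definition zariski_closed_wrt :: "'b list \<Rightarrow> 'b set \<Rightarrow> nat \<Rightarrow> 'b set set \<Rightarrow> bool" where
  "zariski_closed_wrt bs V l Z \<longleftrightarrow>
    (\<exists>S. (\<forall>F\<in>S. \<exists>d. hom_poly (local.plucker_index bs l) d F) \<and>
         Z = {L \<in> local.grassmannian V l. \<forall>F\<in>S. \<forall>p\<in>local.plucker bs l L. F p = 0})"

text \<open>
  The topology induced from projective space by the Pluecker embedding.  It does not depend on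
  the choice of the ordered basis of \<open>V\<close>, so we ask for closedness with respect to all of them.
\<close>

definition zariski :: "'b set \<Rightarrow> nat \<Rightarrow> 'b set topology" where
  "zariski V l = topology (\<lambda>U. U \<subseteq> local.grassmannian V l \<and>
     (\<forall>bs. local.ordered_basis bs V \<longrightarrow> local.zariski_closed_wrt bs V l (local.grassmannian V l - U)))"

end

context vector_space
begin

lemma plucker_proportional:
  assumes bs: "distinct bs" "independent (set bs)"
    and p: "p \<in> plucker bs l L" and q: "q \<in> plucker bs l L"
  shows "\<exists>c. q = (\<lambda>I. c * p I)"
proof -
  let ?h = "length bs"
  from p obtain A where A: "A \<in> carrier_mat l ?h" and LA: "span (row_vec bs A ` {..<l}) = L"
    and pA: "p = (\<lambda>I. if I \<in> plucker_index bs l then det (submatrix A UNIV I) else 0)"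
    by (auto simp: plucker_def)
  from q obtain B where B: "B \<in> carrier_mat l ?h" and LB: "span (row_vec bs B ` {..<l}) = L"
    and qB: "q = (\<lambda>I. if I \<in> plucker_index bs l then det (submatrix B UNIV I) else 0)"
    by (auto simp: plucker_def)
  have ex: "\<exists>u. (\<Sum>b<l. u b *s row_vec bs A b) = x" if "x \<in> L" for x
  proof -
    have L1: "x \<in> span (row_vec bs A ` {..<l})" using that LA by simp
    define T where "T = {x. \<exists>u. (\<Sum>b<l. u b *s row_vec bs A b) = x}"
    have "subspace T"
    proof (rule subspaceI)
      show "0 \<in> T" unfolding T_def by (auto intro!: exI[of _ "\<lambda>_. 0"])
    next
      fix x y assume "x \<in> T" "y \<in> T"
      then obtain u v where "(\<Sum>b<l. u b *s row_vec bs A b) = x" "(\<Sum>b<l. v b *s row_vec bs A b) = y"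
        unfolding T_def by auto
      then have "(\<Sum>b<l. (u b + v b) *s row_vec bs A b) = x + y"
        by (simp add: scale_left_distrib sum.distrib)
      then show "x + y \<in> T" unfolding T_def by (auto intro!: exI[of _ "\<lambda>b. u b + v b"])
    next
      fix c x assume "x \<in> T"
      then obtain u where "(\<Sum>b<l. u b *s row_vec bs A b) = x" unfolding T_def by auto
      then have "(\<Sum>b<l. (c * u b) *s row_vec bs A b) = c *s x"
        by (auto simp: scale_sum_right)
      then show "c *s x \<in> T" unfolding T_def by (auto intro!: exI[of _ "\<lambda>b. c * u b"])
    qed
    moreover have "row_vec bs A ` {..<l} \<subseteq> T"
    proof
      fix y assume "y \<in> row_vec bs A ` {..<l}"
      then obtain a where a: "a < l" "y = row_vec bs A a" by auto
      have "(\<Sum>b<l. (if b = a then 1 else 0) *s row_vec bs A b)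
          = (\<Sum>b<l. if b = a then row_vec bs A b else 0)"
        by (rule sum.cong) auto
      also have "\<dots> = y" using a by simp
      finally show "y \<in> T"
        unfolding T_def by (auto intro!: exI[of _ "\<lambda>b. if b = a then 1 else 0"])
    qed
    ultimately have "span (row_vec bs A ` {..<l}) \<subseteq> T" by (intro span_minimal)
    then show ?thesis using L1 unfolding T_def by auto
  qed
  have "\<exists>u. (\<Sum>b<l. u b *s row_vec bs A b) = row_vec bs B a" if "a < l" for a
  proof (rule ex)
    show "row_vec bs B a \<in> L" unfolding LB[symmetric] using that by (intro span_base imageI) simp
  qed
  then have "\<forall>a. \<exists>u. a < l \<longrightarrow> (\<Sum>b<l. u b *s row_vec bs A b) = row_vec bs B a" by simp
  then obtain u where "\<forall>a. a < l \<longrightarrow> (\<Sum>b<l. u a b *s row_vec bs A b) = row_vec bs B a"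
    by (rule choice[THEN exE])
  then have u: "(\<Sum>b<l. u a b *s row_vec bs A b) = row_vec bs B a" if "a < l" for a
    using that by simp
  define C where "C = mat l l (\<lambda>(a, b). u a b)"
  have C: "C \<in> carrier_mat l l" by (simp add: C_def)
  have inj: "f j = g j" if eq: "(\<Sum>j<?h. f j *s bs ! j) = (\<Sum>j<?h. g j *s bs ! j)" and j: "j < ?h"
    for f g :: "nat \<Rightarrow> 'a" and j
  proof -
    define k where "k x = (let i = the_inv_into {..<?h} (nth bs) x in f i - g i)" for x
    have ib: "inj_on (nth bs) {..<?h}" using bs(1) by (simp add: inj_on_nth)
    have k: "k (bs ! i) = f i - g i" if "i < ?h" for i
      unfolding k_def using that ib by (simp add: the_inv_into_f_f Let_def)
    have "(\<Sum>x\<in>set bs. k x *s x) = (\<Sum>x\<in>nth bs ` {..<?h}. k x *s x)"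
      by (rule sum.cong) (auto simp: set_conv_nth)
    also have "\<dots> = (\<Sum>i<?h. k (bs ! i) *s bs ! i)" using ib by (simp add: sum.reindex)
    also have "\<dots> = (\<Sum>i<?h. (f i - g i) *s bs ! i)" using k by (intro sum.cong) auto
    also have "\<dots> = 0" using eq by (simp add: scale_left_diff_distrib sum_subtractf)
    finally have "k (bs ! j) = 0"
      using independentD[OF bs(2), of "set bs" k "bs ! j"] j by auto
    then show ?thesis using k j by simp
  qed
  have BCA: "B = C * A"
  proof (rule eq_matI)
    fix a j assume "a < dim_row (C * A)" "j < dim_col (C * A)"
    then have a: "a < l" and j: "j < ?h" using A C by auto
    have "(\<Sum>j<?h. B $$ (a, j) *s bs ! j) = (\<Sum>b<l. u a b *s row_vec bs A b)"
      using u[OF a] by (simp add: row_vec_def)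
    also have "\<dots> = (\<Sum>b<l. \<Sum>j<?h. (u a b * A $$ (b, j)) *s bs ! j)"
      by (simp add: row_vec_def scale_sum_right)
    also have "\<dots> = (\<Sum>j<?h. (\<Sum>b<l. u a b * A $$ (b, j)) *s bs ! j)"
      by (subst sum.swap) (simp add: scale_sum_left)
    finally have "B $$ (a, j) = (\<Sum>b<l. u a b * A $$ (b, j))" by (rule inj[OF _ j])
    also have "\<dots> = (C * A) $$ (a, j)"
      using A a j by (auto simp: C_def scalar_prod_def lessThan_atLeast0 intro!: sum.cong)
    finally show "B $$ (a, j) = (C * A) $$ (a, j)" .
  qed (use A B C in auto)
  have "det (submatrix B UNIV I) = det C * det (submatrix A UNIV I)"
    if I: "I \<in> plucker_index bs l" for I
  proof -
    have cI: "card {j. j < ?h \<and> j \<in> I} = l"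
    proof -
      have "{j. j < ?h \<and> j \<in> I} = I" using I by (auto simp: plucker_index_def)
      then show ?thesis using I by (simp add: plucker_index_def)
    qed
    have pk: "pick I j < ?h" if "j < l" for j
      using pick_in_set_le[of j I] I that by (auto simp: plucker_index_def)
    have sA: "submatrix A UNIV I \<in> carrier_mat l l"
      using A cI by (intro carrier_matI) (simp_all add: dim_submatrix)
    have "submatrix B UNIV I = C * submatrix A UNIV I"
    proof (rule eq_matI)
      fix a j assume "a < dim_row (C * submatrix A UNIV I)" "j < dim_col (C * submatrix A UNIV I)"
      then have a: "a < l" and j: "j < l" using C sA by auto
      have "submatrix B UNIV I $$ (a, j) = (C * A) $$ (a, pick I j)"
        unfolding BCA[symmetric] using a j B cI by (simp add: submatrix_index pick_UNIV)
      also have "\<dots> = (\<Sum>b<l. C $$ (a, b) * A $$ (b, pick I j))"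
        using A C a pk[OF j] by (auto simp: scalar_prod_def lessThan_atLeast0 intro!: sum.cong)
      also have "\<dots> = (\<Sum>b<l. C $$ (a, b) * submatrix A UNIV I $$ (b, j))"
        using A j cI by (intro sum.cong) (auto simp: submatrix_index pick_UNIV)
      also have "\<dots> = (C * submatrix A UNIV I) $$ (a, j)"
        using C sA a j by (auto simp: scalar_prod_def lessThan_atLeast0 intro!: sum.cong)
      finally show "submatrix B UNIV I $$ (a, j) = (C * submatrix A UNIV I) $$ (a, j)" .
    qed (use B C sA cI in \<open>auto simp: dim_submatrix\<close>)
    then show ?thesis using det_mult[OF C sA] by simp
  qed
  then have "q = (\<lambda>I. det C * p I)" by (auto simp: pA qB)
  then show ?thesis by blast
qed

end

context vector_space
begin

lemma zariski_closed_wrt_Un: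
  assumes "ordered_basis bs V" "zariski_closed_wrt bs V l Y" "zariski_closed_wrt bs V l Z"
  shows "zariski_closed_wrt bs V l (Y \<union> Z)"
proof -
  from assms(2) obtain S where S: "\<forall>F\<in>S. \<exists>d. hom_poly (plucker_index bs l) d F"
    and Y: "Y = {L \<in> grassmannian V l. \<forall>F\<in>S. \<forall>p\<in>plucker bs l L. F p = 0}"
    by (auto simp: zariski_closed_wrt_def)
  from assms(3) obtain T where T: "\<forall>F\<in>T. \<exists>d. hom_poly (plucker_index bs l) d F"
    and Z: "Z = {L \<in> grassmannian V l. \<forall>F\<in>T. \<forall>p\<in>plucker bs l L. F p = 0}"
    by (auto simp: zariski_closed_wrt_def)
  define R where "R = {(\<lambda>p. F p * G p) | F G. F \<in> S \<and> G \<in> T}"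
  have zero: "F q = 0" if "hom_poly (plucker_index bs l) d F" "p \<in> plucker bs l L"
    "q \<in> plucker bs l L" "F p = 0" for F d p q L
    using plucker_proportional[OF _ _ that(2,3)] assms(1) hom_poly_scale[OF that(1)] that(4)
    by (auto simp: ordered_basis_def)
  have "\<forall>F\<in>R. \<exists>d. hom_poly (plucker_index bs l) d F"
    using S T unfolding R_def by (blast intro: hom_poly.mult)
  moreover have "Y \<union> Z = {L \<in> grassmannian V l. \<forall>F\<in>R. \<forall>p\<in>plucker bs l L. F p = 0}"
  proof (intro equalityI subsetI)
    fix L assume "L \<in> Y \<union> Z"
    then show "L \<in> {L \<in> grassmannian V l. \<forall>F\<in>R. \<forall>p\<in>plucker bs l L. F p = 0}"
      unfolding Y Z R_def by auto
  next
    fix L assume L: "L \<in> {L \<in> grassmannian V l. \<forall>F\<in>R. \<forall>p\<in>plucker bs l L. F p = 0}"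
    show "L \<in> Y \<union> Z"
    proof (rule ccontr)
      assume "L \<notin> Y \<union> Z"
      then obtain F p G q where "F \<in> S" "p \<in> plucker bs l L" "F p \<noteq> 0"
        "G \<in> T" "q \<in> plucker bs l L" "G q \<noteq> 0"
        using L unfolding Y Z by auto
      then have "G p \<noteq> 0" using T zero by blast
      have "(\<lambda>p. F p * G p) \<in> R"
        using \<open>F \<in> S\<close> \<open>G \<in> T\<close> unfolding R_def by blast
      moreover have "\<forall>H\<in>R. \<forall>p\<in>plucker bs l L. H p = 0" using L by simp
      ultimately have "\<forall>p\<in>plucker bs l L. F p * G p = 0" by (rule bspec[rotated])
      with \<open>p \<in> plucker bs l L\<close> have "F p * G p = 0" by (rule bspec[rotated])
      with \<open>F p \<noteq> 0\<close> \<open>G p \<noteq> 0\<close> show False by simp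
    qed
  qed
  ultimately show ?thesis unfolding zariski_closed_wrt_def by blast
qed

lemma zariski_closed_wrt_Inter:
  assumes "\<And>U. U \<in> K \<Longrightarrow> zariski_closed_wrt bs V l (grassmannian V l - U)"
  shows "zariski_closed_wrt bs V l (grassmannian V l - \<Union>K)"
proof -
  have "\<forall>U\<in>K. \<exists>S. (\<forall>F\<in>S. \<exists>d. hom_poly (plucker_index bs l) d F) \<and>
     grassmannian V l - U = {L \<in> grassmannian V l. \<forall>F\<in>S. \<forall>p\<in>plucker bs l L. F p = 0}"
    using assms unfolding zariski_closed_wrt_def by simp
  from bchoice[OF this] obtain S where S: "\<forall>U\<in>K. (\<forall>F\<in>S U. \<exists>d. hom_poly (plucker_index bs l) d F) \<and>
     grassmannian V l - U = {L \<in> grassmannian V l. \<forall>F\<in>S U. \<forall>p\<in>plucker bs l L. F p = 0}"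
    by (elim exE)
  have notin: "L \<notin> U \<longleftrightarrow> (\<forall>F\<in>S U. \<forall>p\<in>plucker bs l L. F p = 0)"
    if "L \<in> grassmannian V l" "U \<in> K" for L U
    using bspec[OF S that(2)] that(1) by blast
  have "grassmannian V l - \<Union>K =
      {L \<in> grassmannian V l. \<forall>F\<in>(\<Union>U\<in>K. S U). \<forall>p\<in>plucker bs l L. F p = 0}"
  proof (intro equalityI subsetI)
    fix L assume "L \<in> grassmannian V l - \<Union>K"
    then have "L \<in> grassmannian V l" "\<forall>U\<in>K. L \<notin> U" by auto
    then show "L \<in> {L \<in> grassmannian V l. \<forall>F\<in>(\<Union>U\<in>K. S U). \<forall>p\<in>plucker bs l L. F p = 0}"
      using notin by simp
  next
    fix L assume "L \<in> {L \<in> grassmannian V l. \<forall>F\<in>(\<Union>U\<in>K. S U). \<forall>p\<in>plucker bs l L. F p = 0}"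
    then have "L \<in> grassmannian V l" "\<forall>U\<in>K. \<forall>F\<in>S U. \<forall>p\<in>plucker bs l L. F p = 0" by simp_all
    then show "L \<in> grassmannian V l - \<Union>K"
      using notin by simp
  qed
  moreover have "\<forall>F\<in>(\<Union>U\<in>K. S U). \<exists>d. hom_poly (plucker_index bs l) d F" using S by blast
  ultimately show ?thesis unfolding zariski_closed_wrt_def by blast
qed

end

context vector_space
begin

lemma openin_zariski:
  "openin (zariski V l) U \<longleftrightarrow> U \<subseteq> grassmannian V l \<and>
     (\<forall>bs. ordered_basis bs V \<longrightarrow> zariski_closed_wrt bs V l (grassmannian V l - U))"
proof -
  have "istopology (\<lambda>U. U \<subseteq> grassmannian V l \<and>
     (\<forall>bs. ordered_basis bs V \<longrightarrow> zariski_closed_wrt bs V l (grassmannian V l - U)))"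
    (is "istopology ?P")
    unfolding istopology_def
  proof (intro conjI allI impI)
    fix U W assume U: "?P U" and W: "?P W"
    show "U \<inter> W \<subseteq> grassmannian V l" using U by blast
    fix bs assume "ordered_basis bs V"
    then show "zariski_closed_wrt bs V l (grassmannian V l - U \<inter> W)"
      unfolding Diff_Int using U W by (intro zariski_closed_wrt_Un) blast+
  next
    fix K assume K: "\<forall>U\<in>K. ?P U"
    show "\<Union>K \<subseteq> grassmannian V l" using K by blast
    fix bs assume "ordered_basis bs V"
    then show "zariski_closed_wrt bs V l (grassmannian V l - \<Union>K)"
      using K by (intro zariski_closed_wrt_Inter) blast
  qed
  then show ?thesis unfolding zariski_def by (simp add: topology_inverse')
qed

end

section \<open>Algebras and finite-dimensional right modules\<close>

locale fd_algebra = vector_space scaleB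
  for scaleB :: "'k::field \<Rightarrow> 'b::ring_1 \<Rightarrow> 'b" +
  assumes scaleB_mult_left: "scaleB c a * b = scaleB c (a * b)"
    and scaleB_mult_right: "a * scaleB c b = scaleB c (a * b)"
    and fd: "\<exists>S. finite S \<and> span S = UNIV"

text \<open>
  Every finite-dimensional vector space is isomorphic to a subspace of the space of sequences, which
  serves as the universe for the underlying spaces of all modules.
\<close>

type_synonym 'k kvec = "nat \<Rightarrow> 'k"

definition vscale :: "'k::field \<Rightarrow> 'k kvec \<Rightarrow> 'k kvec" where
  "vscale c v = (\<lambda>i. c * v i)"

definition hscale :: "'k::field \<Rightarrow> ('k kvec \<Rightarrow> 'k kvec) \<Rightarrow> 'k kvec \<Rightarrow> 'k kvec" where
  "hscale c f = (\<lambda>v. vscale c (f v))"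

global_interpretation kv: vector_space "vscale :: 'k::field \<Rightarrow> 'k kvec \<Rightarrow> 'k kvec"
  by unfold_locales (auto simp: vscale_def fun_eq_iff algebra_simps)

global_interpretation hv: vector_space
  "hscale :: 'k::field \<Rightarrow> ('k kvec \<Rightarrow> 'k kvec) \<Rightarrow> 'k kvec \<Rightarrow> 'k kvec"
  by unfold_locales (auto simp: hscale_def vscale_def fun_eq_iff algebra_simps)

text \<open>
  Linear maps between subspaces \<open>V\<close> and \<open>W\<close>, represented by functions vanishing outside \<open>V\<close>, so
  that equality of maps is equality of functions.
\<close>

definition lin_maps :: "('k \<Rightarrow> 'v \<Rightarrow> 'v) \<Rightarrow> ('k \<Rightarrow> 'w \<Rightarrow> 'w) \<Rightarrow>
    'v::ab_group_add set \<Rightarrow> 'w::ab_group_add set \<Rightarrow> ('v \<Rightarrow> 'w) set" where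
  "lin_maps s t V W = {f. (\<forall>x. x \<notin> V \<longrightarrow> f x = 0) \<and> (\<forall>x\<in>V. f x \<in> W) \<and>
     (\<forall>x\<in>V. \<forall>y\<in>V. f (x + y) = f x + f y) \<and> (\<forall>c. \<forall>x\<in>V. f (s c x) = t c (f x))}"

definition id_map :: "'v::zero set \<Rightarrow> 'v \<Rightarrow> 'v" where
  "id_map V = (\<lambda>x. if x \<in> V then x else 0)"

text \<open>
  A right module structure on a subspace \<open>carr X\<close>; the values of \<open>act X\<close> outside \<open>carr X\<close> are irrelevant.
\<close>

record ('k, 'b) rmod =
  carr :: "'k kvec set"
  act :: "'k kvec \<Rightarrow> 'b \<Rightarrow> 'k kvec"

definition fd_rmod :: "('k::field \<Rightarrow> 'b::ring_1 \<Rightarrow> 'b) \<Rightarrow> ('k, 'b) rmod \<Rightarrow> bool" where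
  "fd_rmod scaleB X \<longleftrightarrow> kv.fd_subspace (carr X) \<and>
     (\<forall>x\<in>carr X. \<forall>b. act X x b \<in> carr X) \<and>
     (\<forall>x\<in>carr X. act X x 1 = x) \<and>
     (\<forall>x\<in>carr X. \<forall>a b. act X x (a * b) = act X (act X x a) b) \<and>
     (\<forall>x\<in>carr X. \<forall>y\<in>carr X. \<forall>b. act X (x + y) b = act X x b + act X y b) \<and>
     (\<forall>x\<in>carr X. \<forall>a b. act X x (a + b) = act X x a + act X x b) \<and>
     (\<forall>x\<in>carr X. \<forall>b c. act X (vscale c x) b = vscale c (act X x b)) \<and>
     (\<forall>x\<in>carr X. \<forall>b c. act X x (scaleB c b) = vscale c (act X x b))"

definition Hom :: "('k::field, 'b) rmod \<Rightarrow> ('k, 'b) rmod \<Rightarrow> ('k kvec \<Rightarrow> 'k kvec) set" where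
  "Hom X Y = {f \<in> lin_maps vscale vscale (carr X) (carr Y).
     \<forall>x\<in>carr X. \<forall>b. f (act X x b) = act Y (f x) b}"

abbreviation End :: "('k::field, 'b) rmod \<Rightarrow> ('k kvec \<Rightarrow> 'k kvec) set" where
  "End X \<equiv> Hom X X"

definition Aut :: "('k::field, 'b) rmod \<Rightarrow> ('k kvec \<Rightarrow> 'k kvec) set" where
  "Aut X = {f \<in> End X. bij_betw f (carr X) (carr X)}"

definition rmod_iso :: "('k::field, 'b) rmod \<Rightarrow> ('k, 'b) rmod \<Rightarrow> bool" where
  "rmod_iso X Y \<longleftrightarrow> (\<exists>f\<in>Hom X Y. bij_betw f (carr X) (carr Y))"

text \<open>
  The finite direct sum: a sequence \<open>v\<close> encodes the family of the sequences \<open>component j v\<close>.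
\<close>

definition component :: "nat \<Rightarrow> 'k kvec \<Rightarrow> 'k kvec" where
  "component j v = (\<lambda>i. v (prod_encode (j, i)))"

definition dsum :: "('k::field, 'b) rmod list \<Rightarrow> ('k, 'b) rmod" where
  "dsum Xs = \<lparr>
     carr = {v. (\<forall>j<length Xs. component j v \<in> carr (Xs ! j)) \<and>
                (\<forall>j\<ge>length Xs. component j v = 0)},
     act = (\<lambda>v b n. case prod_decode n of (j, i) \<Rightarrow>
              if j < length Xs then act (Xs ! j) (component j v) b i else 0)\<rparr>"

definition indecomposable :: "('k::field \<Rightarrow> 'b::ring_1 \<Rightarrow> 'b) \<Rightarrow> ('k, 'b) rmod \<Rightarrow> bool" where
  "indecomposable scaleB X \<longleftrightarrow> carr X \<noteq> {0} \<and>
     (\<forall>Y Z. fd_rmod scaleB Y \<and> fd_rmod scaleB Z \<and> rmod_iso X (dsum [Y, Z]) \<longrightarrow>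
        carr Y = {0} \<or> carr Z = {0})"

section \<open>Visible modules\<close>

definition visible_indecs ::
  "('k::field \<Rightarrow> 'b::ring_1 \<Rightarrow> 'b) \<Rightarrow> ('k, 'b) rmod \<Rightarrow> ('k, 'b) rmod set" where
  "visible_indecs scaleB E =
     {X. fd_rmod scaleB X \<and> indecomposable scaleB X \<and> Hom E X \<noteq> {0}}"

definition visible_finite ::
  "('k::field \<Rightarrow> 'b::ring_1 \<Rightarrow> 'b) \<Rightarrow> ('k, 'b) rmod \<Rightarrow> bool" where
  "visible_finite scaleB E \<longleftrightarrow> finite (visible_indecs scaleB E //
     {(X, Y). X \<in> visible_indecs scaleB E \<and> Y \<in> visible_indecs scaleB E \<and> rmod_iso X Y})"

definition visible_representatives ::
  "('k::field \<Rightarrow> 'b::ring_1 \<Rightarrow> 'b) \<Rightarrow> ('k, 'b) rmod \<Rightarrow> ('k, 'b) rmod list \<Rightarrow> bool" where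
  "visible_representatives scaleB E Xs \<longleftrightarrow> set Xs \<subseteq> visible_indecs scaleB E \<and>
     (\<forall>i<length Xs. \<forall>j<length Xs. rmod_iso (Xs ! i) (Xs ! j) \<longrightarrow> i = j) \<and>
     (\<forall>X\<in>visible_indecs scaleB E. \<exists>Y\<in>set Xs. rmod_iso X Y)"

definition mult_sum :: "('k::field, 'b) rmod list \<Rightarrow> nat list \<Rightarrow> ('k, 'b) rmod" where
  "mult_sum Xs m = dsum (concat (map2 replicate m Xs))"

definition h_dim :: "('k::field, 'b) rmod \<Rightarrow> ('k, 'b) rmod list \<Rightarrow> nat list \<Rightarrow> nat" where
  "h_dim E Xs m = hv.dim (Hom E (mult_sum Xs m))"

definition r_dim :: "('k::field, 'b) rmod list \<Rightarrow> nat list \<Rightarrow> nat" where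
  "r_dim Xs m = hv.dim (End (mult_sum Xs m))"

section \<open>Stabilisers and orbits\<close>

definition push :: "('k kvec \<Rightarrow> 'k kvec) \<Rightarrow> ('k kvec \<Rightarrow> 'k kvec) set \<Rightarrow> ('k kvec \<Rightarrow> 'k kvec) set"
  where "push f L = (\<lambda>\<phi>. f \<circ> \<phi>) ` L"

definition Stab ::
  "('k::field, 'b) rmod \<Rightarrow> ('k kvec \<Rightarrow> 'k kvec) set \<Rightarrow> ('k kvec \<Rightarrow> 'k kvec) set" where
  "Stab N L = {f \<in> End N. push f L \<subseteq> L}"

definition brick_locus ::
  "('k::field, 'b) rmod \<Rightarrow> ('k, 'b) rmod \<Rightarrow> nat \<Rightarrow> ('k kvec \<Rightarrow> 'k kvec) set set" where
  "brick_locus E N l =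
     {L \<in> hv.grassmannian (Hom E N) l. Stab N L = {hscale c (id_map (carr N)) | c. True}}"

definition aut_orbits :: "('k::field, 'b) rmod \<Rightarrow> ('k kvec \<Rightarrow> 'k kvec) set set \<Rightarrow>
    ('k kvec \<Rightarrow> 'k kvec) set set set" where
  "aut_orbits N \<L> = (\<lambda>L. {push f L | f. f \<in> Aut N}) ` \<L>"

section \<open>Modules over the one-point extension\<close>

text \<open>
  Finite-dimensional right modules over the one-point extension \<open>B[E]\<close>, described as triples
  \<open>(N, W, \<eta>)\<close> of a right \<open>B\<close>-module \<open>N\<close>, a finite-dimensional space \<open>W\<close> and a linear map
  \<open>\<eta>\<close> from \<open>W\<close> to \<open>Hom E N\<close>.
\<close>

record ('k, 'b) triple =
  base :: "('k, 'b) rmod"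
  vtx :: "'k kvec set"
  str :: "'k kvec \<Rightarrow> 'k kvec \<Rightarrow> 'k kvec"

definition opext_mod ::
  "('k::field \<Rightarrow> 'b::ring_1 \<Rightarrow> 'b) \<Rightarrow> ('k, 'b) rmod \<Rightarrow> ('k, 'b) triple set" where
  "opext_mod scaleB E = {M. fd_rmod scaleB (base M) \<and> kv.fd_subspace (vtx M) \<and>
     str M \<in> lin_maps vscale hscale (vtx M) (Hom E (base M))}"

definition triple_Hom :: "('k::field, 'b) triple \<Rightarrow> ('k, 'b) triple \<Rightarrow>
    (('k kvec \<Rightarrow> 'k kvec) \<times> ('k kvec \<Rightarrow> 'k kvec)) set" where
  "triple_Hom M M' = {(f, g). f \<in> Hom (base M) (base M') \<and>
     g \<in> lin_maps vscale vscale (vtx M) (vtx M') \<and>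
     (\<forall>w\<in>vtx M. f \<circ> str M w = str M' (g w))}"

definition triple_iso :: "('k::field, 'b) triple \<Rightarrow> ('k, 'b) triple \<Rightarrow> bool" where
  "triple_iso M M' \<longleftrightarrow> (\<exists>(f, g)\<in>triple_Hom M M'.
     bij_betw f (carr (base M)) (carr (base M')) \<and> bij_betw g (vtx M) (vtx M'))"

definition is_brick :: "('k::field, 'b) triple \<Rightarrow> bool" where
  "is_brick M \<longleftrightarrow> (carr (base M) \<noteq> {0} \<or> vtx M \<noteq> {0}) \<and>
     triple_Hom M M =
       {(hscale c (id_map (carr (base M))), hscale c (id_map (vtx M))) | c. True}"

definition mixed_bricks ::
  "('k::field \<Rightarrow> 'b::ring_1 \<Rightarrow> 'b) \<Rightarrow> ('k, 'b) rmod \<Rightarrow> ('k, 'b) triple set" where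
  "mixed_bricks scaleB E =
     {M \<in> opext_mod scaleB E. is_brick M \<and> carr (base M) \<noteq> {0} \<and> vtx M \<noteq> {0}}"

definition triple_iso_classes :: "('k::field, 'b) triple set \<Rightarrow> ('k, 'b) triple set set" where
  "triple_iso_classes \<M> = \<M> // {(M, M'). M \<in> \<M> \<and> M' \<in> \<M> \<and> triple_iso M M'}"

end

theory Submission
  imports Defs
begin

text \<open>
  Put \<open>V = Hom E N\<close> for the module \<open>N\<close> of the theorem and let \<open>id, f\<^sub>1, \<dots>, f\<^sub>s\<close> be a basis of
  \<open>End N\<close>, so that \<open>s = r - 1\<close>.  The stabiliser of a subspace \<open>L\<close> of \<open>V\<close> is the kernel of the linear map
  \<open>End N \<rightarrow> Hom(L, V/L)\<close> sending \<open>f\<close> to the map induced by composition with \<open>f\<close>.  The identity always lies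
  in it, hence \<open>L\<close> belongs to the brick locus if and only if the \<open>s\<close> maps \<open>L \<rightarrow> V/L\<close> induced by the
  \<open>f\<^sub>k\<close> are linearly independent; in other words, if no nontrivial combination of the \<open>f\<^sub>k\<close> carries \<open>L\<close> into
  itself.  The inequality and the openness are properties of this independence condition, for any finite
  family of endomorphisms of a finite-dimensional space \<open>V\<close>.

  The inequality holds because \<open>Hom(L, V/L)\<close>, the tangent space of the Grassmannian at \<open>L\<close>, has dimension
  \<open>l (h - l)\<close>.  For openness, independence means that some \<open>s \<times> s\<close> minor of the \<open>s\<close> induced maps does not
  vanish (lemma \<open>exists_nonzero_minor\<close>).  On the chart of the Grassmannian where a chosen Pluecker
  coordinate \<open>D\<close> is nonzero, \<open>L\<close> has a unique basis that restricts to the identity matrix on the chosen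
  columns, and by Cramer's rule its entries are quotients of Pluecker coordinates by \<open>D\<close>.  With respect to
  this basis the entries of the induced maps, multiplied by \<open>D\<^sup>2\<close>, are quadratic forms in the Pluecker
  coordinates.  A minor of these forms, multiplied once more by \<open>D\<close>, is a form that vanishes off the
  chart, so all such products together cut out the complement of the locus globally
  (\<open>zariski_closed_wrt_no_stable_combination\<close>).

  For the bijection, the structure map \<open>\<eta>\<close> of a mixed brick \<open>(N', W, \<eta>)\<close> is injective: for a
  projection \<open>g\<close> of \<open>W\<close> onto a line in its kernel, \<open>(0, g)\<close> would be an endomorphism that is not a
  scalar.  So a mixed brick is, up to the choice of \<open>W\<close>, the same thing as the subspace \<open>\<eta>(W)\<close> of
  \<open>Hom E N'\<close>, and its endomorphisms are the elements of the stabiliser of \<open>\<eta>(W)\<close>.  Moving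
  \<open>\<eta>(W)\<close> to \<open>Hom E N\<close> along all isomorphisms \<open>N' \<rightarrow> N\<close> gives exactly one orbit of \<open>Aut N\<close>, and two
  bricks are isomorphic if and only if their orbits coincide (\<open>triple_iso_iff_iso_orbit_eq\<close>).
\<close>

section \<open>Minors and linear independence\<close>

text \<open>
  By induction on \<open>s\<close>: extend a nonzero minor of the first \<open>s\<close> functions by one column, the values at a
  variable point \<open>x\<close>.  The Laplace expansion along that column is a combination of the functions whose last
  coefficient is the old minor, so by independence it is nonzero for some \<open>x\<close>.
\<close>

lemma exists_nonzero_minor:
  fixes q :: "nat \<Rightarrow> 'c \<Rightarrow> 'k::field"
  assumes "\<And>a. (\<forall>x\<in>C. (\<Sum>i<s. a i * q i x) = 0) \<Longrightarrow> \<forall>i<s. a i = 0"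
  shows "\<exists>\<gamma>. (\<forall>j<s. \<gamma> j \<in> C) \<and> det (mat s s (\<lambda>(i, j). q i (\<gamma> j))) \<noteq> 0"
  using assms
proof (induction s)
  case 0
  then show ?case by (simp add: det_dim_zero)
next
  case (Suc s)
  have "\<forall>i<s. a i = 0" if "\<forall>x\<in>C. (\<Sum>i<s. a i * q i x) = 0" for a
  proof -
    have "\<forall>i<Suc s. (a(s := 0)) i = 0" using that by (intro Suc.prems) simp
    then show ?thesis by (metis fun_upd_other less_Suc_eq less_irrefl_nat)
  qed
  then obtain \<gamma> where \<gamma>: "\<forall>j<s. \<gamma> j \<in> C" and d: "det (mat s s (\<lambda>(i, j). q i (\<gamma> j))) \<noteq> 0"
    using Suc.IH by blast
  define M where "M x = mat (Suc s) (Suc s) (\<lambda>(i, j). q i ((\<gamma>(s := x)) j))" for x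
  define k where "k i = (-1) ^ (i + s) *
      det (mat s s (\<lambda>(i', j). q (if i' < i then i' else Suc i') (\<gamma> j)))" for i
  have del: "mat_delete (M x) i s = mat s s (\<lambda>(i', j). q (if i' < i then i' else Suc i') (\<gamma> j))"
    if "i < Suc s" for x i
    using that by (intro eq_matI) (auto simp: mat_delete_def M_def)
  have detM: "det (M x) = (\<Sum>i<Suc s. k i * q i x)" for x
  proof -
    have "det (M x) = (\<Sum>i<Suc s. M x $$ (i, s) * cofactor (M x) i s)"
      by (rule laplace_expansion_column) (auto simp: M_def)
    also have "\<dots> = (\<Sum>i<Suc s. k i * q i x)"
      by (rule sum.cong) (auto simp: cofactor_def k_def del, auto simp: M_def)
    finally show ?thesis .
  qed
  have "mat s s (\<lambda>(i', j). q (if i' < s then i' else Suc i') (\<gamma> j)) = mat s s (\<lambda>(i, j). q i (\<gamma> j))"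
    by (rule eq_matI) auto
  then have "k s \<noteq> 0" using d by (simp add: k_def)
  then obtain x where x: "x \<in> C" "det (M x) \<noteq> 0"
    using Suc.prems[of k] unfolding detM by blast
  have "\<forall>j<Suc s. (\<gamma>(s := x)) j \<in> C" using \<gamma> x(1) by auto
  with x(2) show ?case unfolding M_def by blast
qed

lemma coeffs_zero_if_nonzero_minor:
  fixes q :: "nat \<Rightarrow> 'c \<Rightarrow> 'k::field"
  assumes d: "det (mat s s (\<lambda>(i, j). q i (\<gamma> j))) \<noteq> 0"
    and 0: "\<And>j. j < s \<Longrightarrow> (\<Sum>i<s. a i * q i (\<gamma> j)) = 0" and "i < s"
  shows "a i = 0"
proof (rule ccontr)
  assume a: "a i \<noteq> 0"
  define M where "M = mat s s (\<lambda>(i, j). q i (\<gamma> j))"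
  have M: "M\<^sup>T \<in> carrier_mat s s" by (simp add: M_def)
  have "vec s a \<noteq> 0\<^sub>v s" using a \<open>i < s\<close> by (metis index_vec index_zero_vec(1))
  moreover have "M\<^sup>T *\<^sub>v vec s a = 0\<^sub>v s"
    using 0 by (intro eq_vecI) (auto simp: M_def scalar_prod_def lessThan_atLeast0 mult.commute)
  ultimately have "det M\<^sup>T = 0"
    using det_0_iff_vec_prod_zero[OF M] by (metis vec_carrier)
  then show False using d det_transpose[of M s] by (simp add: M_def)
qed

text \<open>
  The columns are listed by a function, not by a set, so that replacing one of them keeps the place of the
  others; the price is that columns may repeat.
\<close>

definition column_minor :: "'k::field mat \<Rightarrow> nat \<Rightarrow> (nat \<Rightarrow> nat) \<Rightarrow> 'k" where
  "column_minor A l c = det (mat l l (\<lambda>(a, b). A $$ (a, c b)))"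

lemma column_minor_repeated:
  assumes "i < l" "i' < l" "i \<noteq> i'" "c i = c i'"
  shows "column_minor A l c = 0"
  unfolding column_minor_def
  by (rule det_identical_columns[OF _ assms(3,1,2)]) (use assms in \<open>auto intro!: eq_vecI\<close>)

text \<open>
  Cramer's rule: the columns in \<open>c\<close> form an invertible matrix, and solving for the coefficients that
  express column \<open>j\<close> in terms of them gives these quotients.
\<close>

lemma column_minor_cramer:
  assumes d: "column_minor A l c \<noteq> 0" and a: "a < l"
  shows "A $$ (a, j) = (\<Sum>i<l. A $$ (a, c i) * (column_minor A l (c(i := j)) / column_minor A l c))"
proof -
  define M where "M = mat l l (\<lambda>(a, b). A $$ (a, c b))"
  define w where "w = vec l (\<lambda>a. A $$ (a, j))"
  have M: "M \<in> carrier_mat l l" and w: "w \<in> carrier_vec l" by (auto simp: M_def w_def)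
  have dM: "det M = column_minor A l c" by (simp add: M_def column_minor_def)
  then obtain N where N: "N \<in> carrier_mat l l" "M * N = 1\<^sub>m l"
    using det_non_zero_imp_unit[OF M, of "()"] d
    by (auto simp: Units_def ring_mat_simps)
  define x where "x = N *\<^sub>v w"
  have x: "x \<in> carrier_vec l" using N w by (simp add: x_def)
  have Mx: "M *\<^sub>v x = w"
    using assoc_mult_mat_vec[OF M N(1) w] N(2) w by (simp add: x_def)
  have xi: "x $ i = column_minor A l (c(i := j)) / column_minor A l c" if "i < l" for i
  proof -
    have "replace_col M w i = mat l l (\<lambda>(a, b). A $$ (a, (c(i := j)) b))"
      using that by (intro eq_matI) (auto simp: replace_col_def M_def w_def)
    then have "column_minor A l (c(i := j)) = x $ i * column_minor A l c"
      using cramer_lemma_mat[OF M x that] by (simp add: Mx dM column_minor_def)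
    then show ?thesis using d by simp
  qed
  have "A $$ (a, j) = (M *\<^sub>v x) $ a" unfolding Mx using a by (simp add: w_def)
  also have "\<dots> = (\<Sum>i<l. A $$ (a, c i) * x $ i)"
    using a x by (auto simp: M_def scalar_prod_def lessThan_atLeast0 intro!: sum.cong)
  finally show ?thesis using xi by simp
qed

text \<open>
  The Pluecker coordinate vector of the row space of \<open>A\<close>.
\<close>

definition maximal_minors :: "nat \<Rightarrow> nat \<Rightarrow> 'k::field mat \<Rightarrow> nat set \<Rightarrow> 'k" where
  "maximal_minors h l A =
    (\<lambda>I. if I \<in> {I. I \<subseteq> {..<h} \<and> card I = l} then det (submatrix A UNIV I) else 0)"

text \<open>
  The hypothesis is needed because every form in an empty set of variables has degree \<open>0\<close>.
\<close>

lemma hom_poly_zero: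
  assumes "K \<noteq> {}"
  shows "hom_poly K d (\<lambda>p. 0)"
proof (induction d)
  case 0
  show ?case by (rule hom_poly.const)
next
  case (Suc d)
  from assms obtain i where "i \<in> K" by blast
  from hom_poly.mult[OF Suc hom_poly.var[OF this]] show ?case by simp
qed

lemma hom_poly_sum:
  assumes "K \<noteq> {}" "\<And>x. x \<in> X \<Longrightarrow> hom_poly K d (F x)"
  shows "hom_poly K d (\<lambda>p. \<Sum>x\<in>X. F x p)"
  using assms(2)
  by (induction X rule: infinite_finite_induct)
     (auto simp: hom_poly_zero[OF assms(1)] intro: hom_poly.add)

lemma hom_poly_cmult: "hom_poly K d F \<Longrightarrow> hom_poly K d (\<lambda>p. c * F p)"
  using hom_poly.mult[OF hom_poly.const[of K c]] by simp

lemma hom_poly_prod: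
  assumes "finite X" "\<And>x. x \<in> X \<Longrightarrow> hom_poly K d (F x)"
  shows "hom_poly K (card X * d) (\<lambda>p. \<Prod>x\<in>X. F x p)"
  using assms
proof (induction X)
  case empty
  show ?case using hom_poly.const[of K 1] by simp
next
  case (insert x X)
  then show ?case using hom_poly.mult[of K d "F x" "card X * d"] by simp
qed

lemma hom_poly_det:
  assumes "K \<noteq> {}" "\<And>i j. i < s \<Longrightarrow> j < s \<Longrightarrow> hom_poly K d (F i j)"
  shows "hom_poly K (s * d) (\<lambda>p. det (mat s s (\<lambda>(i, j). F i j p)))"
proof -
  have e: "det (mat s s (\<lambda>(i, j). F i j p)) =
      (\<Sum>\<sigma> | \<sigma> permutes {0..<s}. signof \<sigma> * (\<Prod>i = 0..<s. F i (\<sigma> i) p))" for p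
    by (subst det_def'[of _ s])
       (auto intro!: sum.cong prod.cong simp: permutes_in_image)
  have "hom_poly K (s * d) (\<lambda>p. signof \<sigma> * (\<Prod>i = 0..<s. F i (\<sigma> i) p))"
    if "\<sigma> permutes {0..<s}" for \<sigma>
  proof -
    have "\<sigma> i < s" if "i < s" for i
      using permutes_in_image[OF \<open>\<sigma> permutes {0..<s}\<close>, of i] that by simp
    then show ?thesis
      using hom_poly_prod[of "{0..<s}" K d "\<lambda>i. F i (\<sigma> i)"] assms(2) by (intro hom_poly_cmult) simp
  qed
  then show ?thesis unfolding e by (intro hom_poly_sum[OF assms(1)]) auto
qed

text \<open>
  If the columns repeat, the form is zero.  Otherwise \<open>c\<close> enumerates its range \<open>I\<close> in an order that
  differs from the increasing one by a permutation, and the form is the coordinate at \<open>I\<close> times the sign.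
\<close>

lemma column_minor_linear_form:
  assumes l: "l \<le> h" and c: "c ` {..<l} \<subseteq> {..<h}"
  shows "\<exists>G. hom_poly {I. I \<subseteq> {..<h} \<and> card I = l} 1 G \<and>
     (\<forall>A\<in>carrier_mat l h. G (maximal_minors h l A) = column_minor (A :: 'k::field mat) l c)"
    (is "\<exists>G. hom_poly ?K 1 G \<and> _")
proof (cases "inj_on c {..<l}")
  case False
  have "{..<l} \<in> ?K" using l by auto
  then have "hom_poly ?K 1 (\<lambda>p. 0)" by (intro hom_poly_zero) blast
  moreover have "column_minor A l c = 0" for A :: "'k mat"
    using False column_minor_repeated unfolding inj_on_def by blast
  ultimately show ?thesis by auto
next
  case True
  define I where "I = c ` {..<l}"
  have I: "I \<in> ?K" and cI: "card I = l" using c True by (auto simp: I_def card_image)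
  have I': "{j. j < h \<and> j \<in> I} = I" using c by (auto simp: I_def)
  define \<sigma> where "\<sigma> b = (if b < l then card {a\<in>I. a < c b} else b)" for b
  have pick: "pick I (\<sigma> b) = c b" if "b < l" for b
    using that by (simp add: \<sigma>_def I_def pick_card_in_set)
  have \<sigma>l: "\<sigma> b < l" if "b < l" for b
  proof -
    have "finite I" by (simp add: I_def)
    moreover have "{a\<in>I. a < c b} \<subset> I" using that by (auto simp: I_def)
    ultimately have "card {a\<in>I. a < c b} < card I" by (rule psubset_card_mono)
    then show ?thesis using that cI by (simp add: \<sigma>_def)
  qed
  have "inj_on \<sigma> {0..<l}"
  proof (rule inj_onI)
    fix a b assume "a \<in> {0..<l}" "b \<in> {0..<l}" "\<sigma> a = \<sigma> b"
    then have "c a = c b" using pick[of a] pick[of b] by simp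
    with \<open>a \<in> _\<close> \<open>b \<in> _\<close> show "a = b" using True by (auto simp: inj_on_def)
  qed
  then have \<sigma>: "\<sigma> permutes {0..<l}"
    using \<sigma>l endo_inj_surj[of "{0..<l}" \<sigma>]
    by (intro bij_imp_permutes) (auto simp: bij_betw_def image_subset_iff, simp_all add: \<sigma>_def)
  have "column_minor A l c = signof \<sigma> * det (submatrix A UNIV I)"
    if A: "A \<in> carrier_mat l h" for A :: "'k mat"
  proof -
    let ?S = "submatrix A UNIV I"
    have S: "?S \<in> carrier_mat l l"
      using A I' cI by (intro carrier_matI) (simp_all add: dim_submatrix)
    have Si: "?S $$ (a, b) = A $$ (a, pick I b)" if "a < l" "b < l" for a b
      using A that I' cI by (simp add: submatrix_index pick_UNIV)
    have "mat l l (\<lambda>(a, b). A $$ (a, c b)) = (mat l l (\<lambda>(a, b). ?S\<^sup>T $$ (\<sigma> a, b)))\<^sup>T"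
      using S Si \<sigma>l pick by (intro eq_matI) auto
    then have "column_minor A l c = det (mat l l (\<lambda>(a, b). ?S\<^sup>T $$ (\<sigma> a, b)))"
      unfolding column_minor_def by (simp add: det_transpose[of _ l])
    also have "\<dots> = signof \<sigma> * det ?S"
      using S by (subst det_permute_rows[OF _ \<sigma>]) (auto simp: det_transpose)
    finally show ?thesis .
  qed
  then have "\<forall>A\<in>carrier_mat l h. signof \<sigma> * maximal_minors h l A I = column_minor (A :: 'k mat) l c"
    using I by (simp add: maximal_minors_def)
  moreover have "hom_poly ?K 1 (\<lambda>p. signof \<sigma> * p I :: 'k)"
    by (intro hom_poly_cmult hom_poly.var I)
  ultimately show ?thesis by blast
qed

section \<open>Finite-dimensional subspaces and maps between them\<close>

lemma (in vector_space_pair) additive_lincomb: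
  assumes sub: "vs1.subspace V"
    and add: "\<And>v w. v \<in> V \<Longrightarrow> w \<in> V \<Longrightarrow> f (v + w) = f v + f w"
    and scale: "\<And>r v. v \<in> V \<Longrightarrow> f (s1 r v) = s2 r (f v)"
    and "\<And>i. i \<in> I \<Longrightarrow> w i \<in> V"
  shows "f (\<Sum>i\<in>I. s1 (r i) (w i)) = (\<Sum>i\<in>I. s2 (r i) (f (w i)))"
proof -
  have f0: "f 0 = 0" using scale[of 0 0] vs1.subspace_0[OF sub] by simp
  show ?thesis using assms(4)
  proof (induction I rule: infinite_finite_induct)
    case (insert x I)
    have "(\<Sum>i\<in>I. s1 (r i) (w i)) \<in> V" "s1 (r x) (w x) \<in> V"
      using insert.prems by (auto intro!: vs1.subspace_sum[OF sub] vs1.subspace_scale[OF sub])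
    then show ?case using insert add scale by simp
  qed (simp_all add: f0)
qed

context vector_space
begin

definition linear_endo :: "'b set \<Rightarrow> ('b \<Rightarrow> 'b) \<Rightarrow> bool" where
  "linear_endo V f \<longleftrightarrow> (\<forall>v\<in>V. f v \<in> V) \<and> (\<forall>v\<in>V. \<forall>w\<in>V. f (v + w) = f v + f w) \<and>
     (\<forall>r. \<forall>v\<in>V. f (r *s v) = r *s f v)"

text \<open>
  Linear independence of the maps \<open>L \<rightarrow> V/L\<close> induced by the \<open>f k\<close>, without mention of the quotient.
\<close>

definition no_stable_combination :: "nat \<Rightarrow> (nat \<Rightarrow> 'b \<Rightarrow> 'b) \<Rightarrow> 'b set \<Rightarrow> bool" where
  "no_stable_combination s f L \<longleftrightarrow>
     (\<forall>a. (\<forall>v\<in>L. (\<Sum>k<s. a k *s f k v) \<in> L) \<longrightarrow> (\<forall>k<s. a k = 0))"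

lemma span_eq_if_card_le_dim:
  assumes "finite X" "card X \<le> dim L" "L \<subseteq> span X" "subspace L"
  shows "span X = L"
proof -
  obtain B where B: "B \<subseteq> L" "independent B" "L \<subseteq> span B" "card B = dim L"
    using basis_exists[of L] by blast
  obtain C where C: "B \<subseteq> C" "C \<subseteq> span X" "independent C" "span X \<subseteq> span C"
    using maximal_independent_subset_extend[of B "span X"] B(1,2) assms(3) by blast
  have "finite C" "card C \<le> card X" using independent_span_bound[OF assms(1) C(3,2)] by auto
  then have "B = C" using card_seteq[OF _ C(1)] B(4) assms(2) by simp
  then have "span X \<subseteq> L" using C(4) B(1) assms(4) span_minimal by blast
  then show ?thesis using assms(3) by blast
qed

lemma subspace_if_fd: "fd_subspace V \<Longrightarrow> subspace V"
  by (auto simp: fd_subspace_def)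

lemma fd_subspace_if_subset_span:
  assumes "subspace V" "finite S" "V \<subseteq> span S"
  shows "fd_subspace V"
proof -
  obtain B where B: "B \<subseteq> V" "independent B" "V \<subseteq> span B"
    using maximal_independent_subset[of V] by blast
  have "finite B" using independent_span_bound[OF assms(2) B(2)] B(1) assms(3) by blast
  moreover have "span B = V" using B(1,3) span_minimal[OF B(1) assms(1)] by auto
  ultimately show ?thesis by (auto simp: fd_subspace_def)
qed

lemma ordered_basis_extending:
  assumes V: "fd_subspace V" and S: "distinct S" "independent (set S)" "set S \<subseteq> V"
  obtains T where "ordered_basis (S @ T) V"
proof -
  obtain F where F: "finite F" "span F = V" using V by (auto simp: fd_subspace_def)
  obtain B where B: "set S \<subseteq> B" "B \<subseteq> V" "independent B" "V \<subseteq> span B"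
    using maximal_independent_subset_extend[OF S(3,2)] by blast
  have "finite B" using independent_span_bound[OF F(1) B(3)] B(2) F(2) by simp
  then obtain T where T: "set T = B - set S" "distinct T"
    using finite_distinct_list[of "B - set S"] by blast
  have "set (S @ T) = B" using T(1) B(1) by auto
  moreover have "span B = V" using B(2,4) span_minimal[OF B(2) subspace_if_fd[OF V]] by auto
  ultimately have "ordered_basis (S @ T) V" using S(1) T B(3) by (auto simp: ordered_basis_def)
  then show ?thesis by (rule that)
qed

lemma ordered_basis_exists:
  assumes "fd_subspace V"
  obtains bs where "ordered_basis bs V" "length bs = dim V"
proof -
  obtain T where T: "ordered_basis ([] @ T) V"
    by (rule ordered_basis_extending[OF assms, of "[]"]) (auto simp: independent_empty)
  then have "length T = dim V"
    using dim_span_eq_card_independent[of "set T"] by (simp add: ordered_basis_def distinct_card)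
  then show ?thesis using that[of T] T by simp
qed

end

lemma (in vector_space_pair) fd_subspace_injective_image:
  assumes V: "vs1.fd_subspace V" and inj: "inj_on f V"
    and add: "\<And>v w. v \<in> V \<Longrightarrow> w \<in> V \<Longrightarrow> f (v + w) = f v + f w"
    and scale: "\<And>r v. v \<in> V \<Longrightarrow> f (s1 r v) = s2 r (f v)"
  shows "vs2.fd_subspace (f ` V)" and "vs2.dim (f ` V) = vs1.dim V"
proof -
  obtain bs where bs: "vs1.ordered_basis bs V" and len: "length bs = vs1.dim V"
    using vs1.ordered_basis_exists[OF V] .
  let ?B = "set bs"
  have d: "distinct bs" and ind: "vs1.independent ?B" and sp: "vs1.span ?B = V"
    using bs by (auto simp: vs1.ordered_basis_def)
  have sub: "vs1.subspace V" by (rule vs1.subspace_if_fd[OF V])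
  have BV: "?B \<subseteq> V" using sp vs1.span_superset by blast
  have f0: "f 0 = 0" using scale[of 0 0] vs1.subspace_0[OF sub] by simp
  have lin: "f (\<Sum>b\<in>?B. s1 (u b) b) = (\<Sum>b\<in>?B. s2 (u b) (f b))" for u
    using BV by (intro additive_lincomb[OF sub add scale]) auto
  have injB: "inj_on f ?B" using inj BV by (rule inj_on_subset)
  have fV: "f ` V = vs2.span (f ` ?B)"
  proof
    show "f ` V \<subseteq> vs2.span (f ` ?B)"
    proof (rule image_subsetI)
      fix v assume "v \<in> V"
      then obtain u where "v = (\<Sum>b\<in>?B. s1 (u b) b)"
        using sp vs1.span_finite[of ?B] by auto
      then show "f v \<in> vs2.span (f ` ?B)"
        by (simp only: lin) (intro vs2.span_sum vs2.span_scale vs2.span_base imageI)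
    qed
    have "vs2.subspace (f ` V)"
    proof (rule vs2.subspaceI)
      show "0 \<in> f ` V" using f0 vs1.subspace_0[OF sub] by (metis imageI)
    next
      fix x y assume "x \<in> f ` V" "y \<in> f ` V"
      then show "x + y \<in> f ` V" using add vs1.subspace_add[OF sub] by (auto simp flip: add)
    next
      fix c x assume "x \<in> f ` V"
      then show "s2 c x \<in> f ` V" using scale vs1.subspace_scale[OF sub] by (auto simp flip: scale)
    qed
    then show "vs2.span (f ` ?B) \<subseteq> f ` V" using BV by (intro vs2.span_minimal) auto
  qed
  then show "vs2.fd_subspace (f ` V)" unfolding vs2.fd_subspace_def by (metis List.finite_set finite_imageI)
  have "vs2.independent (f ` ?B)"
  proof (rule vs2.independent_if_scalars_zero)
    fix u y assume 0: "(\<Sum>y\<in>f ` ?B. s2 (u y) y) = 0" and y: "y \<in> f ` ?B"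
    have "f (\<Sum>b\<in>?B. s1 (u (f b)) b) = f 0"
      using 0 by (simp add: lin sum.reindex[OF injB] f0)
    moreover have "(\<Sum>b\<in>?B. s1 (u (f b)) b) \<in> V"
      using BV by (auto intro!: vs1.subspace_sum[OF sub] vs1.subspace_scale[OF sub])
    ultimately have "(\<Sum>b\<in>?B. s1 (u (f b)) b) = 0"
      using inj vs1.subspace_0[OF sub] by (simp add: inj_on_def)
    then show "u y = 0" using vs1.independentD[OF ind, of ?B "\<lambda>b. u (f b)"] y by auto
  qed simp
  then show "vs2.dim (f ` V) = vs1.dim V"
    using vs2.dim_span_eq_card_independent[of "f ` ?B"] fV len d
    by (simp add: card_image[OF injB] distinct_card)
qed

section \<open>Coordinates and charts of the Grassmannian\<close>

locale based_space = vector_space scale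
  for scale :: "'a::field \<Rightarrow> 'b::ab_group_add \<Rightarrow> 'b" (infixr "*s" 75) +
  fixes bs :: "'b list" and V :: "'b set"
  assumes bs: "ordered_basis bs V"
begin

definition coord :: "'b \<Rightarrow> nat \<Rightarrow> 'a" where
  "coord v j = representation (set bs) v (bs ! j)"

lemma sum_coord:
  assumes "v \<in> V"
  shows "(\<Sum>j<length bs. coord v j *s bs ! j) = v"
proof -
  have b: "distinct bs" "independent (set bs)" "span (set bs) = V"
    using bs by (auto simp: ordered_basis_def)
  have "set bs = (!) bs ` {..<length bs}" by (auto simp: set_conv_nth)
  moreover have "inj_on ((!) bs) {..<length bs}" using b(1) by (simp add: inj_on_nth)
  ultimately have "(\<Sum>j<length bs. coord v j *s bs ! j)
      = (\<Sum>b\<in>set bs. representation (set bs) v b *s b)"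
    by (simp add: sum.reindex coord_def)
  also have "\<dots> = v" using b assms by (intro sum_representation_eq) auto
  finally show ?thesis .
qed

lemma
  shows coord_add: "v \<in> V \<Longrightarrow> w \<in> V \<Longrightarrow> coord (v + w) j = coord v j + coord w j"
    and coord_scale: "v \<in> V \<Longrightarrow> coord (r *s v) j = r * coord v j"
    and coord_zero: "coord 0 j = 0"
  using bs
  by (auto simp: coord_def ordered_basis_def representation_add representation_scale
       representation_zero)

lemma subspace_V: "subspace V"
  using bs by (auto simp: ordered_basis_def)

lemma basis_nth: "j < length bs \<Longrightarrow> bs ! j \<in> V"
  using bs by (auto simp: ordered_basis_def intro: span_base)

lemma length_basis: "length bs = dim V"
  using bs dim_span_eq_card_independent[of "set bs"]
  by (simp add: ordered_basis_def distinct_card)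

lemma coord_lincomb:
  assumes "\<And>i. i \<in> X \<Longrightarrow> w i \<in> V"
  shows "coord (\<Sum>i\<in>X. r i *s w i) j = (\<Sum>i\<in>X. r i * coord (w i) j)"
  using assms
proof (induction X rule: infinite_finite_induct)
  case (insert x X)
  have "(\<Sum>i\<in>X. r i *s w i) \<in> V" "r x *s w x \<in> V"
    using insert subspace_V
    by (auto intro!: subspace_sum subspace_scale)
  then show ?case using insert by (simp add: coord_add coord_scale)
qed (simp_all add: coord_zero)

lemma coord_basis:
  assumes "i < length bs" "j < length bs"
  shows "coord (bs ! i) j = (if j = i then 1 else 0)"
  using assms bs by (auto simp: coord_def ordered_basis_def representation_basis nth_eq_iff_index_eq)

lemma coord_eqI:
  assumes "v \<in> V" "w \<in> V" "\<And>j. j < length bs \<Longrightarrow> coord v j = coord w j"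
  shows "v = w"
proof -
  have "(\<Sum>j<length bs. coord v j *s bs ! j) = (\<Sum>j<length bs. coord w j *s bs ! j)"
    using assms(3) by (intro sum.cong) auto
  then show ?thesis using sum_coord[OF assms(1)] sum_coord[OF assms(2)] by simp
qed

lemma coord_row_vec:
  assumes "j < length bs"
  shows "coord (\<Sum>i<length bs. k i *s bs ! i) j = k j"
proof -
  have "coord (\<Sum>i<length bs. k i *s bs ! i) j = (\<Sum>i<length bs. k i * coord (bs ! i) j)"
    by (intro coord_lincomb basis_nth) simp
  also have "\<dots> = (\<Sum>i<length bs. if i = j then k i else 0)"
    using assms by (intro sum.cong) (auto simp: coord_basis)
  also have "\<dots> = k j" using assms by simp
  finally show ?thesis .
qed

text \<open>
  A basis of \<open>L\<close> whose coordinate matrix is the identity on the pivot columns \<open>c\<close>.  Its other entries are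
  the coordinates of \<open>L\<close> in a standard chart of the Grassmannian.
\<close>

definition reduced_basis :: "'b set \<Rightarrow> nat \<Rightarrow> (nat \<Rightarrow> nat) \<Rightarrow> (nat \<Rightarrow> 'b) \<Rightarrow> bool" where
  "reduced_basis L l c x \<longleftrightarrow> span (x ` {..<l}) = L \<and> c ` {..<l} \<subseteq> {..<length bs} \<and>
     (\<forall>i<l. \<forall>i'<l. coord (x i) (c i') = (if i = i' then 1 else 0))"

definition minor_vec :: "'a mat \<Rightarrow> nat \<Rightarrow> (nat \<Rightarrow> nat) \<Rightarrow> nat \<Rightarrow> 'b" where
  "minor_vec A l c i =
     (\<Sum>j<length bs. (column_minor A l (c(i := j)) / column_minor A l c) *s bs ! j)"

text \<open>
  By Cramer's rule every row of \<open>A\<close> is a combination of these vectors, and there are only \<open>dim L\<close> of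
  them, so they span exactly \<open>L\<close>.
\<close>

lemma reduced_basis_minor_vec:
  assumes L: "span (row_vec bs A ` {..<l}) = L" "dim L = l"
    and c: "c ` {..<l} \<subseteq> {..<length bs}" and d: "column_minor A l c \<noteq> 0"
  shows "reduced_basis L l c (minor_vec A l c)"
  unfolding reduced_basis_def
proof (intro conjI allI impI)
  let ?x = "minor_vec A l c"
  have row: "row_vec bs A a = (\<Sum>i<l. A $$ (a, c i) *s ?x i)" if "a < l" for a
  proof -
    have "row_vec bs A a = (\<Sum>j<length bs. (\<Sum>i<l. A $$ (a, c i) *
        (column_minor A l (c(i := j)) / column_minor A l c)) *s bs ! j)"
      unfolding row_vec_def
      by (intro sum.cong refl arg_cong[where f = "\<lambda>r. r *s _"] column_minor_cramer[OF d that])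
    also have "\<dots> = (\<Sum>i<l. A $$ (a, c i) *s ?x i)"
      unfolding minor_vec_def scale_sum_left scale_sum_right by (subst sum.swap) simp
    finally show ?thesis .
  qed
  have "row_vec bs A ` {..<l} \<subseteq> span (?x ` {..<l})"
  proof (rule image_subsetI)
    fix a assume "a \<in> {..<l}"
    then show "row_vec bs A a \<in> span (?x ` {..<l})"
      by (simp only: row lessThan_iff) (intro span_sum span_scale span_base imageI)
  qed
  then have "L \<subseteq> span (?x ` {..<l})" unfolding L(1)[symmetric] by (intro span_minimal) auto
  moreover have "card (?x ` {..<l}) \<le> dim L" using card_image_le[of "{..<l}" ?x] L(2) by simp
  moreover have "subspace L" unfolding L(1)[symmetric] by simp
  ultimately show "span (?x ` {..<l}) = L" by (intro span_eq_if_card_le_dim) simp_all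
  show "c ` {..<l} \<subseteq> {..<length bs}" by (rule c)
  fix i i' assume i: "i < l" "i' < l"
  have "c i' < length bs" using c i by auto
  then have "coord (?x i) (c i') = column_minor A l (c(i := c i')) / column_minor A l c"
    unfolding minor_vec_def by (rule coord_row_vec)
  moreover have "column_minor A l (c(i := c i')) = 0" if "i \<noteq> i'"
    using that i by (intro column_minor_repeated[of i l i']) auto
  ultimately show "coord (?x i) (c i') = (if i = i' then 1 else 0)" using d by auto
qed

text \<open>
  Every point of the Grassmannian lies in some chart: the rows of \<open>A\<close> are the coordinates of a basis, and
  their independence yields a nonzero maximal minor.
\<close>

lemma grassmannian_matrix:
  assumes L: "L \<in> grassmannian V l"
  obtains A c where "A \<in> carrier_mat l (length bs)" "span (row_vec bs A ` {..<l}) = L"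
    "c ` {..<l} \<subseteq> {..<length bs}" "column_minor A l c \<noteq> 0"
proof -
  obtain S where S: "finite S" "span S = L" and LV: "L \<subseteq> V" and l: "dim L = l"
    using L by (auto simp: grassmannian_def fd_subspace_def)
  obtain B where B: "B \<subseteq> L" "independent B" "L \<subseteq> span B" "card B = l"
    using basis_exists[of L] l by blast
  have "finite B" using independent_span_bound[OF S(1) B(2)] B(1) S(2) by simp
  then obtain ys where ys: "set ys = B" "distinct ys" using finite_distinct_list[of B] by blast
  have len: "length ys = l" using distinct_card[OF ys(2)] ys(1) B(4) by simp
  have sB: "span B = L" using B(1,3) span_minimal[OF B(1)] subspace_span[of S] S(2) by auto
  then have ob: "ordered_basis ys L" using ys B by (simp add: ordered_basis_def)
  interpret L: based_space scale ys L by unfold_locales (rule ob)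
  define A where "A = mat l (length bs) (\<lambda>(a, j). coord (ys ! a) j)"
  have ysV: "ys ! a \<in> V" if "a < l" for a using that ys len B(1) LV by (metis nth_mem subsetD)
  have row: "row_vec bs A a = ys ! a" if "a < l" for a
  proof -
    have "row_vec bs A a = (\<Sum>j<length bs. coord (ys ! a) j *s bs ! j)"
      unfolding row_vec_def A_def using that by (intro sum.cong) auto
    then show ?thesis using sum_coord[OF ysV[OF that]] by simp
  qed
  have "row_vec bs A ` {..<l} = set ys" using row len by (auto simp: set_conv_nth image_def)
  then have "span (row_vec bs A ` {..<l}) = L" using ys sB by simp
  moreover have "\<exists>c. (\<forall>j<l. c j \<in> {..<length bs}) \<and> det (mat l l (\<lambda>(i, j). A $$ (i, c j))) \<noteq> 0"
  proof (rule exists_nonzero_minor)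
    fix u assume u: "\<forall>j\<in>{..<length bs}. (\<Sum>i<l. u i * A $$ (i, j)) = 0"
    have "coord (\<Sum>i<l. u i *s ys ! i) j = 0" if "j < length bs" for j
    proof -
      have "coord (\<Sum>i<l. u i *s ys ! i) j = (\<Sum>i<l. u i * coord (ys ! i) j)"
        by (rule coord_lincomb) (use ysV in auto)
      also have "\<dots> = (\<Sum>i<l. u i * A $$ (i, j))"
        using that by (intro sum.cong) (auto simp: A_def)
      finally show ?thesis using u that by simp
    qed
    moreover have "(\<Sum>i<l. u i *s ys ! i) \<in> V"
      using ysV subspace_V by (auto intro!: subspace_sum subspace_scale)
    moreover have "0 \<in> V" using subspace_V by (rule subspace_0)
    ultimately have "(\<Sum>i<l. u i *s ys ! i) = 0"
      using coord_eqI coord_zero by metis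
    then show "\<forall>i<l. u i = 0" using L.coord_row_vec[of _ u] len L.coord_zero by metis
  qed
  then obtain c where "\<forall>j<l. c j < length bs" "column_minor A l c \<noteq> 0"
    by (auto simp: column_minor_def)
  ultimately show ?thesis using that[of A c] by (auto simp: A_def)
qed

lemma linear_endo_lincomb:
  assumes f: "linear_endo V f" and w: "\<And>i. i \<in> X \<Longrightarrow> w i \<in> V"
  shows "f (\<Sum>i\<in>X. r i *s w i) = (\<Sum>i\<in>X. r i *s f (w i))"
proof -
  interpret vector_space_pair scale scale by unfold_locales
  show ?thesis
    using f by (intro additive_lincomb[OF subspace_V _ _ w]) (auto simp: linear_endo_def)
qed

text \<open>
  The vector \<open>f (x i)\<close> differs from the element of \<open>L\<close> with the same pivot coordinates by a vector
  that represents it modulo \<open>L\<close>; the \<open>(i, j)\<close> entry is the \<open>j\<close>-th coordinate of that difference.  So this is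
  the matrix of the induced map \<open>L \<rightarrow> V/L\<close>.
\<close>

definition deviation :: "nat \<Rightarrow> (nat \<Rightarrow> nat) \<Rightarrow> (nat \<Rightarrow> 'b) \<Rightarrow> ('b \<Rightarrow> 'b) \<Rightarrow> nat \<times> nat \<Rightarrow> 'a" where
  "deviation l c x f = (\<lambda>(i, j).
     coord (f (x i)) j - (\<Sum>i'<l. coord (f (x i)) (c i') * coord (x i') j))"

context
  fixes L l c x
  assumes LV: "L \<subseteq> V" and x: "reduced_basis L l c x"
begin

lemma reduced_basis_in: "i < l \<Longrightarrow> x i \<in> L"
  using x by (auto simp: reduced_basis_def intro: span_base)

lemma reduced_basis_sum_in: "(\<Sum>i<l. r i *s x i) \<in> L"
proof -
  have "subspace L" using x by (auto simp: reduced_basis_def)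
  then show ?thesis using reduced_basis_in by (intro subspace_sum subspace_scale) auto
qed

lemma coord_reduced_basis_sum: "i' < l \<Longrightarrow> coord (\<Sum>i<l. r i *s x i) (c i') = r i'"
proof -
  assume i': "i' < l"
  have "coord (\<Sum>i<l. r i *s x i) (c i') = (\<Sum>i<l. r i * coord (x i) (c i'))"
    by (rule coord_lincomb) (use reduced_basis_in LV in auto)
  also have "\<dots> = (\<Sum>i<l. if i = i' then r i else 0)"
    using x i' by (intro sum.cong) (auto simp: reduced_basis_def)
  finally show ?thesis using i' by simp
qed

lemma reduced_basis_expand:
  assumes "w \<in> L"
  shows "w = (\<Sum>i<l. coord w (c i) *s x i)"
proof -
  have "w \<in> span (x ` {..<l})" using assms x by (simp add: reduced_basis_def)
  then have "\<exists>r. w = (\<Sum>i<l. r i *s x i)"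
  proof (induction rule: span_induct_alt)
    case base
    show ?case by (intro exI[of _ "\<lambda>_. 0"]) simp
  next
    case (step k y z)
    then obtain i r where i: "i < l" "y = x i" "z = (\<Sum>i<l. r i *s x i)" by auto
    have "(\<Sum>i'<l. (r i' + (if i' = i then k else 0)) *s x i')
        = z + (\<Sum>i'<l. if i' = i then k *s x i' else 0)"
      unfolding i(3) sum.distrib[symmetric] scale_left_distrib by (intro sum.cong) auto
    also have "\<dots> = k *s y + z" using i by simp
    finally show ?case by (intro exI[of _ "\<lambda>i'. r i' + (if i' = i then k else 0)"]) simp
  qed
  then obtain r where r: "w = (\<Sum>i<l. r i *s x i)" by blast
  then show ?thesis using coord_reduced_basis_sum[of _ r] by simp
qed

lemma deviation_eq_0_iff:
  assumes "linear_endo V f" "i < l"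
  shows "(\<forall>j<length bs. deviation l c x f (i, j) = 0) \<longleftrightarrow> f (x i) \<in> L"
proof -
  let ?w = "f (x i)" and ?u = "\<Sum>i'<l. coord (f (x i)) (c i') *s x i'"
  have w: "?w \<in> V" using assms reduced_basis_in LV by (auto simp: linear_endo_def)
  have uL: "?u \<in> L" by (rule reduced_basis_sum_in)
  have "coord ?u j = (\<Sum>i'<l. coord ?w (c i') * coord (x i') j)" for j
    by (rule coord_lincomb) (use reduced_basis_in LV in auto)
  then have "deviation l c x f (i, j) = coord ?w j - coord ?u j" for j
    by (simp add: deviation_def)
  then have "(\<forall>j<length bs. deviation l c x f (i, j) = 0) \<longleftrightarrow> ?w = ?u"
    using coord_eqI[OF w, of ?u] uL LV by auto
  also have "\<dots> \<longleftrightarrow> ?w \<in> L" using reduced_basis_expand[of ?w] uL by auto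
  finally show ?thesis .
qed

text \<open>
  Only the \<open>dim V - l\<close> columns that are not pivots can carry nonzero entries; they stand for a basis of
  \<open>V/L\<close>.
\<close>

lemma deviation_pivot: "i' < l \<Longrightarrow> deviation l c x f (i, c i') = 0"
proof -
  assume i': "i' < l"
  have "(\<Sum>k<l. coord (f (x i)) (c k) * coord (x k) (c i'))
      = (\<Sum>k<l. if k = i' then coord (f (x i)) (c k) else 0)"
    using x i' by (intro sum.cong) (auto simp: reduced_basis_def)
  then show ?thesis using i' by (simp add: deviation_def)
qed

lemma stable_iff_deviation:
  assumes f: "linear_endo V f"
  shows "(\<forall>v\<in>L. f v \<in> L) \<longleftrightarrow> (\<forall>p\<in>{..<l} \<times> {..<length bs}. deviation l c x f p = 0)"
proof -
  have "(\<forall>v\<in>L. f v \<in> L) \<longleftrightarrow> (\<forall>i<l. f (x i) \<in> L)"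
  proof (intro iffI ballI allI impI)
    fix v assume 1: "\<forall>i<l. f (x i) \<in> L" and v: "v \<in> L"
    have "f v = f (\<Sum>i<l. coord v (c i) *s x i)" using reduced_basis_expand[OF v] by simp
    also have "\<dots> = (\<Sum>i<l. coord v (c i) *s f (x i))"
      by (rule linear_endo_lincomb[OF f])
         (use reduced_basis_in LV in auto)
    also have "\<dots> \<in> L"
      using 1 x by (auto simp: reduced_basis_def intro!: span_sum span_scale)
    finally show "f v \<in> L" .
  qed (use reduced_basis_in in auto)
  also have "\<dots> \<longleftrightarrow> (\<forall>p\<in>{..<l} \<times> {..<length bs}. deviation l c x f p = 0)"
    using deviation_eq_0_iff[OF f] by auto
  finally show ?thesis .
qed

end

lemma linear_endo_sum:
  assumes "subspace V" "\<And>k. k < s \<Longrightarrow> linear_endo V (f k)"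
  shows "linear_endo V (\<lambda>v. \<Sum>k<s. a k *s f k v)"
  using assms(2) unfolding linear_endo_def
  by (auto intro!: subspace_sum subspace_scale assms(1)
      simp: sum.distrib[symmetric] scale_right_distrib scale_sum_right mult.commute)

lemma deviation_sum:
  assumes f: "\<And>k. k < s \<Longrightarrow> f k (x i) \<in> V"
  shows "deviation l c x (\<lambda>v. \<Sum>k<s. a k *s f k v) (i, j)
      = (\<Sum>k<s. a k * deviation l c x (f k) (i, j))"
proof -
  have co: "coord (\<Sum>k<s. a k *s f k (x i)) j = (\<Sum>k<s. a k * coord (f k (x i)) j)" for j
    by (rule coord_lincomb) (use f in auto)
  have "(\<Sum>i'<l. (\<Sum>k<s. a k * coord (f k (x i)) (c i')) * coord (x i') j)
      = (\<Sum>k<s. a k * (\<Sum>i'<l. coord (f k (x i)) (c i') * coord (x i') j))"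
    unfolding sum_distrib_left sum_distrib_right by (subst sum.swap) (simp add: mult.assoc)
  then show ?thesis by (simp add: deviation_def co sum_subtractf right_diff_distrib)
qed

lemma no_stable_combination_iff:
  assumes LV: "L \<subseteq> V" and x: "reduced_basis L l c x"
    and f: "\<And>k. k < s \<Longrightarrow> linear_endo V (f k)"
  shows "no_stable_combination s f L \<longleftrightarrow>
    (\<forall>a. (\<forall>p\<in>{..<l} \<times> {..<length bs}. (\<Sum>k<s. a k * deviation l c x (f k) p) = 0) \<longrightarrow>
       (\<forall>k<s. a k = 0))"
proof -
  have "(\<forall>v\<in>L. (\<Sum>k<s. a k *s f k v) \<in> L) \<longleftrightarrow>
    (\<forall>p\<in>{..<l} \<times> {..<length bs}. (\<Sum>k<s. a k * deviation l c x (f k) p) = 0)" for a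
  proof -
    have "f k (x i) \<in> V" if "k < s" "i < l" for k i
      using f[OF that(1)] reduced_basis_in[OF LV x that(2)] LV unfolding linear_endo_def by blast
    then have "deviation l c x (\<lambda>v. \<Sum>k<s. a k *s f k v) p
        = (\<Sum>k<s. a k * deviation l c x (f k) p)" if "p \<in> {..<l} \<times> {..<length bs}" for p
      using that by (cases p) (auto intro!: deviation_sum)
    moreover have "linear_endo V (\<lambda>v. \<Sum>k<s. a k *s f k v)"
      using subspace_V f by (rule linear_endo_sum)
    ultimately show ?thesis using stable_iff_deviation[OF LV x] by simp
  qed
  then show ?thesis by (simp add: no_stable_combination_def)
qed

text \<open>
  The \<open>s\<close> independent deviations live on the \<open>l (dim V - l)\<close> positions outside the pivot columns.  A nonzero
  \<open>s \<times> s\<close> minor uses distinct positions, so there are at least \<open>s\<close> of them.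
\<close>

lemma dim_le_if_no_stable_combination:
  assumes L: "L \<in> grassmannian V l" and f: "\<And>k. k < s \<Longrightarrow> linear_endo V (f k)"
    and n: "no_stable_combination s f L"
  shows "s \<le> l * (dim V - l)"
proof -
  obtain A c where A: "A \<in> carrier_mat l (length bs)" "span (row_vec bs A ` {..<l}) = L"
    "c ` {..<l} \<subseteq> {..<length bs}" "column_minor A l c \<noteq> 0"
    by (rule grassmannian_matrix[OF L])
  have LV: "L \<subseteq> V" and l: "dim L = l" using L by (auto simp: grassmannian_def)
  define x where "x = minor_vec A l c"
  have x: "reduced_basis L l c x"
    unfolding x_def by (rule reduced_basis_minor_vec[OF A(2) l A(3,4)])
  define C where "C = {..<l} \<times> ({..<length bs} - c ` {..<l})"
  have "\<exists>\<gamma>. (\<forall>j<s. \<gamma> j \<in> C) \<and> det (mat s s (\<lambda>(k, j). deviation l c x (f k) (\<gamma> j))) \<noteq> 0"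
  proof (rule exists_nonzero_minor)
    fix a assume a: "\<forall>p\<in>C. (\<Sum>k<s. a k * deviation l c x (f k) p) = 0"
    have "(\<Sum>k<s. a k * deviation l c x (f k) p) = 0" if "p \<in> {..<l} \<times> {..<length bs}" for p
    proof (cases "p \<in> C")
      case False
      then obtain i i' where "p = (i, c i')" "i' < l" using \<open>p \<in> _\<close> by (auto simp: C_def)
      then show ?thesis using deviation_pivot[OF LV x] by simp
    qed (use a in simp)
    then show "\<forall>k<s. a k = 0"
      by (intro iffD1[OF no_stable_combination_iff[OF LV x f] n, THEN spec, THEN mp] ballI)
  qed
  then obtain \<gamma> where \<gamma>: "\<forall>j<s. \<gamma> j \<in> C"
    and d: "det (mat s s (\<lambda>(k, j). deviation l c x (f k) (\<gamma> j))) \<noteq> 0" by blast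
  have "inj_on \<gamma> {..<s}"
  proof (rule inj_onI, rule ccontr)
    fix i j assume "i \<in> {..<s}" "j \<in> {..<s}" "\<gamma> i = \<gamma> j" "i \<noteq> j"
    then have "det (mat s s (\<lambda>(k, j). deviation l c x (f k) (\<gamma> j))) = 0"
      by (intro det_identical_columns[of _ s i j]) (auto intro!: eq_vecI)
    with d show False by simp
  qed
  then have "s \<le> card C"
    using card_inj_on_le[of \<gamma> "{..<s}" C] \<gamma> by (auto simp: C_def image_subset_iff)
  moreover have "inj_on c {..<l}"
    using column_minor_repeated A(4) unfolding inj_on_def by blast
  then have "card ({..<length bs} - c ` {..<l}) = dim V - l"
    using A(3) by (subst card_Diff_subset) (auto simp: card_image length_basis)
  ultimately show ?thesis by (simp add: C_def card_cartesian_product)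
qed

text \<open>
  Clearing denominators: for the reduced basis given by minors, the square of the pivot minor times the
  deviation is a quadratic expression in the minors \<open>u\<close>, where \<open>t\<close> is \<open>u\<close> times the matrix of \<open>f\<close>.
\<close>

lemma deviation_minor_vec:
  assumes f: "linear_endo V f" and j: "j < length bs" and d: "column_minor A l c \<noteq> 0"
  defines "u \<equiv> \<lambda>i j. column_minor A l (c(i := j))"
  defines "t \<equiv> \<lambda>i j. \<Sum>k<length bs. u i k * coord (f (bs ! k)) j"
  shows "column_minor A l c * t i j - (\<Sum>i'<l. t i (c i') * u i' j)
    = (column_minor A l c)\<^sup>2 * deviation l c (minor_vec A l c) f (i, j)"
proof -
  let ?D = "column_minor A l c" and ?x = "minor_vec A l c"
  have x: "coord (?x i) j = u i j / ?D" if "j < length bs" for i j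
    unfolding minor_vec_def u_def
    by (rule coord_row_vec[OF that, of "\<lambda>j. column_minor A l (c(i := j)) / ?D"])
  have "f (?x i) = (\<Sum>k<length bs. (u i k / ?D) *s f (bs ! k))" for i
    unfolding minor_vec_def u_def
    by (rule linear_endo_lincomb[OF f]) (simp add: basis_nth)
  then have "coord (f (?x i)) j = (\<Sum>k<length bs. (u i k / ?D) * coord (f (bs ! k)) j)" for i j
    by (simp only:) (rule coord_lincomb, use f basis_nth in \<open>auto simp: linear_endo_def\<close>)
  then have t: "coord (f (?x i)) j = t i j / ?D" for i j
    by (simp add: t_def sum_divide_distrib)
  have "deviation l c ?x f (i, j) = t i j / ?D - (\<Sum>i'<l. t i (c i') * u i' j) / ?D\<^sup>2"
    using j by (simp add: deviation_def t x sum_divide_distrib power2_eq_square)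
  then show ?thesis using d by (simp add: field_simps power2_eq_square)
qed

text \<open>
  The equations are the products \<open>F c \<gamma>\<close> of a pivot minor with an \<open>s \<times> s\<close> minor of the cleared deviations
  in the chart of that pivot.  In its own chart a product vanishes exactly when the minor of deviations
  does; outside it vanishes for free, which makes the local criterion a global one.
\<close>

lemma zariski_closed_wrt_no_stable_combination:
  assumes l: "l \<le> dim V" and f: "\<And>k. k < s \<Longrightarrow> linear_endo V (f k)"
  shows "zariski_closed_wrt bs V l
    (grassmannian V l - {L \<in> grassmannian V l. no_stable_combination s f L})"
proof -
  let ?h = "length bs" and ?K = "plucker_index bs l"
  have l: "l \<le> ?h" using l by (simp add: length_basis)
  then have "{..<l} \<in> ?K" by (auto simp: plucker_index_def)
  then have K: "?K \<noteq> {}" by blast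
  have plu: "plucker bs l L = {maximal_minors ?h l A | A.
      A \<in> carrier_mat l ?h \<and> span (row_vec bs A ` {..<l}) = L}" for L
    by (simp add: plucker_def maximal_minors_def plucker_index_def)
  have "\<forall>c. \<exists>G. c ` {..<l} \<subseteq> {..<?h} \<longrightarrow> hom_poly ?K 1 G \<and>
     (\<forall>A\<in>carrier_mat l ?h. G (maximal_minors ?h l A) = column_minor (A :: 'a mat) l c)"
    using column_minor_linear_form[OF l] by (simp add: plucker_index_def) blast
  from choice[OF this] obtain G where "\<forall>c. c ` {..<l} \<subseteq> {..<?h} \<longrightarrow> hom_poly ?K 1 (G c) \<and>
     (\<forall>A\<in>carrier_mat l ?h. G c (maximal_minors ?h l A) = column_minor (A :: 'a mat) l c)"
    by (elim exE)
  then have G: "hom_poly ?K 1 (G c)"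
    and GA: "A \<in> carrier_mat l ?h \<Longrightarrow> G c (maximal_minors ?h l A) = column_minor A l c"
    if "c ` {..<l} \<subseteq> {..<?h}" for c A
    using that by auto
  (* G c is the linear form that computes the minor with columns c from Pluecker coordinates.
     T and P are the forms whose values are t and the cleared deviation of the preceding lemma. *)
  define T where "T k c i j p = (\<Sum>m<?h. G (c(i := m)) p * coord (f k (bs ! m)) j)" for k c i j p
  define P where "P k c = (\<lambda>(i, j) p. G c p * T k c i j p +
      (-1) * (\<Sum>i'<l. T k c i (c i') p * G (c(i' := j)) p))" for k c
  define F where "F c \<gamma> p = G c p * det (mat s s (\<lambda>(k, b). P k c (\<gamma> b) p))" for c \<gamma> p
  define C where "C = {..<l} \<times> {..<?h}"
  define S where "S = {F c \<gamma> | c \<gamma>. c ` {..<l} \<subseteq> {..<?h} \<and> (\<forall>b<s. \<gamma> b \<in> C)}"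
  have upd: "(c(i := j)) ` {..<l} \<subseteq> {..<?h}" if "c ` {..<l} \<subseteq> {..<?h}" "j < ?h" for c i j
    using that by auto
  have T: "hom_poly ?K 1 (T k c i j)" if "c ` {..<l} \<subseteq> {..<?h}" for k c i j
    unfolding T_def
  proof (rule hom_poly_sum[OF K])
    fix m assume "m \<in> {..<?h}"
    then have "hom_poly ?K 1 (G (c(i := m)))" using that by (intro G upd) auto
    then show "hom_poly ?K 1 (\<lambda>p. G (c(i := m)) p * coord (f k (bs ! m)) j)"
      using hom_poly_cmult[of ?K 1 "G (c(i := m))" "coord (f k (bs ! m)) j"]
      by (simp add: mult.commute)
  qed
  have P: "hom_poly ?K (1 + 1) (P k c q)" if c: "c ` {..<l} \<subseteq> {..<?h}" and q: "q \<in> C" for k c q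
  proof -
    obtain i j where ij: "q = (i, j)" and j: "j < ?h" using q by (auto simp: C_def)
    show ?thesis unfolding P_def ij prod.case
      by (intro hom_poly.add hom_poly_cmult hom_poly.mult hom_poly_sum[OF K] G T upd c j)
  qed
  have "hom_poly ?K (1 + s * (1 + 1)) (F c \<gamma>)"
    if "c ` {..<l} \<subseteq> {..<?h}" "\<forall>b<s. \<gamma> b \<in> C" for c \<gamma>
    unfolding F_def using that
    by (intro hom_poly.mult hom_poly_det[OF K] G P) auto
  then have "\<forall>H\<in>S. \<exists>d. hom_poly ?K d H" unfolding S_def by blast
  moreover have "no_stable_combination s f L \<longleftrightarrow> \<not> (\<forall>H\<in>S. \<forall>p\<in>plucker bs l L. H p = 0)"
    if L: "L \<in> grassmannian V l" for L
  proof -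
    have LV: "L \<subseteq> V" and dL: "dim L = l" using L by (auto simp: grassmannian_def)
    have Pdev: "P k c q (maximal_minors ?h l A)
        = (column_minor A l c)\<^sup>2 * deviation l c (minor_vec A l c) (f k) q"
      if A: "A \<in> carrier_mat l ?h" and c: "c ` {..<l} \<subseteq> {..<?h}" and d: "column_minor A l c \<noteq> 0"
        and k: "k < s" and q: "q \<in> C" for A c k q
    proof -
      obtain i j where ij: "q = (i, j)" and j: "j < ?h" using q by (auto simp: C_def)
      have "T k c i j (maximal_minors ?h l A)
          = (\<Sum>m<?h. column_minor A l (c(i := m)) * coord (f k (bs ! m)) j)" for i j
        unfolding T_def using GA[OF upd[OF c] A] by (intro sum.cong) auto
      then show ?thesis
        unfolding deviation_minor_vec[OF f[OF k] j d, symmetric] ij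
        using GA[OF upd[OF c] A] GA[OF c A] j by (simp add: P_def)
    qed
    (* On a chart the deviations may be replaced by the forms P, since they differ by a nonzero factor. *)
    have iff: "no_stable_combination s f L \<longleftrightarrow>
        (\<forall>a. (\<forall>q\<in>C. (\<Sum>k<s. a k * P k c q (maximal_minors ?h l A)) = 0) \<longrightarrow> (\<forall>k<s. a k = 0))"
      if A: "A \<in> carrier_mat l ?h" "span (row_vec bs A ` {..<l}) = L"
        and c: "c ` {..<l} \<subseteq> {..<?h}" and d: "column_minor A l c \<noteq> 0" for A c
    proof -
      have x: "reduced_basis L l c (minor_vec A l c)"
        by (rule reduced_basis_minor_vec[OF A(2) dL c d])
      have "(\<Sum>k<s. a k * P k c q (maximal_minors ?h l A)) = (column_minor A l c)\<^sup>2 *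
          (\<Sum>k<s. a k * deviation l c (minor_vec A l c) (f k) q)" if "q \<in> C" for a q
        unfolding sum_distrib_left using Pdev[OF A(1) c d _ that] by (intro sum.cong) auto
      then show ?thesis
        using no_stable_combination_iff[OF LV x, of s f] f d by (simp add: C_def)
    qed
    show ?thesis
    proof
      assume n: "no_stable_combination s f L"
      obtain A c where A: "A \<in> carrier_mat l ?h" "span (row_vec bs A ` {..<l}) = L"
        and c: "c ` {..<l} \<subseteq> {..<?h}" and d: "column_minor A l c \<noteq> 0"
        by (rule grassmannian_matrix[OF L])
      have "\<exists>\<gamma>. (\<forall>b<s. \<gamma> b \<in> C) \<and>
          det (mat s s (\<lambda>(k, b). P k c (\<gamma> b) (maximal_minors ?h l A))) \<noteq> 0"
        by (rule exists_nonzero_minor) (use n iff[OF A c d] in blast)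
      then obtain \<gamma> where \<gamma>: "\<forall>b<s. \<gamma> b \<in> C"
        "det (mat s s (\<lambda>(k, b). P k c (\<gamma> b) (maximal_minors ?h l A))) \<noteq> 0" by blast
      have "F c \<gamma> (maximal_minors ?h l A) \<noteq> 0" using \<gamma>(2) d GA[OF c A(1)] by (simp add: F_def)
      moreover have "F c \<gamma> \<in> S" using c \<gamma>(1) by (auto simp: S_def)
      moreover have "maximal_minors ?h l A \<in> plucker bs l L" using A by (auto simp: plu)
      ultimately show "\<not> (\<forall>H\<in>S. \<forall>p\<in>plucker bs l L. H p = 0)" by blast
    next
      assume "\<not> (\<forall>H\<in>S. \<forall>p\<in>plucker bs l L. H p = 0)"
      then obtain c \<gamma> A where c: "c ` {..<l} \<subseteq> {..<?h}" and \<gamma>: "\<forall>b<s. \<gamma> b \<in> C"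
        and A: "A \<in> carrier_mat l ?h" "span (row_vec bs A ` {..<l}) = L"
        and nz: "F c \<gamma> (maximal_minors ?h l A) \<noteq> 0"
        unfolding S_def plu by blast
      have d: "column_minor A l c \<noteq> 0" using nz GA[OF c A(1)] by (auto simp: F_def)
      define q where "q k z = P k c z (maximal_minors ?h l A)" for k z
      have "det (mat s s (\<lambda>(k, b). q k (\<gamma> b))) \<noteq> 0"
        using nz by (simp add: F_def q_def)
      then have "\<forall>k<s. a k = 0" if "\<forall>z\<in>C. (\<Sum>k<s. a k * q k z) = 0" for a
        using coeffs_zero_if_nonzero_minor[of s q \<gamma> a] \<gamma> that by simp
      then show "no_stable_combination s f L"
        unfolding iff[OF A c d] q_def by blast
    qed
  qed
  then have "grassmannian V l - {L \<in> grassmannian V l. no_stable_combination s f L}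
      = {L \<in> grassmannian V l. \<forall>H\<in>S. \<forall>p\<in>plucker bs l L. H p = 0}" by auto
  ultimately show ?thesis unfolding zariski_closed_wrt_def by blast
qed

end

context vector_space
begin

lemma openin_zariski_no_stable_combination:
  assumes "l \<le> dim V" and "\<And>k. k < s \<Longrightarrow> linear_endo V (f k)"
  shows "openin (zariski V l) {L \<in> grassmannian V l. no_stable_combination s f L}"
  unfolding openin_zariski
  using based_space.zariski_closed_wrt_no_stable_combination[OF _ assms]
  by (auto simp: based_space_def based_space_axioms_def vector_space_axioms)

end

section \<open>Spaces of module homomorphisms\<close>

global_interpretation kv_hom: vector_space_pair "vscale :: 'k::field \<Rightarrow> _" vscale
  by unfold_locales

global_interpretation kv_hv: vector_space_pair "vscale :: 'k::field \<Rightarrow> _" hscale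
  by unfold_locales

global_interpretation hv_hom: vector_space_pair "hscale :: 'k::field \<Rightarrow> _" hscale
  by unfold_locales

lemma fd_rmodD:
  assumes "fd_rmod sc X"
  shows "kv.fd_subspace (carr X)"
    and "x \<in> carr X \<Longrightarrow> act X x b \<in> carr X"
    and "x \<in> carr X \<Longrightarrow> act X x 1 = x"
    and "x \<in> carr X \<Longrightarrow> act X x (a * b) = act X (act X x a) b"
    and "x \<in> carr X \<Longrightarrow> y \<in> carr X \<Longrightarrow> act X (x + y) b = act X x b + act X y b"
    and "x \<in> carr X \<Longrightarrow> act X x (a + b) = act X x a + act X x b"
    and "x \<in> carr X \<Longrightarrow> act X (vscale c x) b = vscale c (act X x b)"
    and "x \<in> carr X \<Longrightarrow> act X x (sc c b) = vscale c (act X x b)"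
  using assms unfolding fd_rmod_def by blast+

lemma Hom_lin:
  assumes "f \<in> Hom X Y"
  shows "x \<notin> carr X \<Longrightarrow> f x = 0" and "x \<in> carr X \<Longrightarrow> f x \<in> carr Y"
    and "x \<in> carr X \<Longrightarrow> y \<in> carr X \<Longrightarrow> f (x + y) = f x + f y"
    and "x \<in> carr X \<Longrightarrow> f (vscale c x) = vscale c (f x)"
    and "x \<in> carr X \<Longrightarrow> f (act X x b) = act Y (f x) b"
  using assms by (auto simp: Hom_def lin_maps_def)

lemma fd_rmod_subspace: "fd_rmod sc X \<Longrightarrow> kv.subspace (carr X)"
  by (auto simp: fd_rmod_def intro: kv.subspace_if_fd)

lemma fd_rmod_zero: "fd_rmod sc X \<Longrightarrow> 0 \<in> carr X"
  using fd_rmod_subspace kv.subspace_0 by blast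

lemma act_zero:
  assumes "fd_rmod sc X"
  shows "act X 0 b = 0"
proof -
  have "act X (vscale 0 0) b = vscale 0 (act X 0 b)"
    using assms fd_rmod_zero[OF assms] unfolding fd_rmod_def by blast
  then show ?thesis by simp
qed

lemma Hom_0:
  assumes "fd_rmod sc X" "f \<in> Hom X Y"
  shows "f 0 = 0"
  using Hom_lin(4)[OF assms(2) fd_rmod_zero[OF assms(1)], of 0] by simp

lemma Hom_in_carr:
  assumes "fd_rmod sc Y" "f \<in> Hom X Y"
  shows "f x \<in> carr Y"
  using Hom_lin(1,2)[OF assms(2), of x] fd_rmod_zero[OF assms(1)] by (cases "x \<in> carr X") auto

text \<open>
  The values of \<open>act Y\<close> outside \<open>carr Y\<close> are arbitrary; homomorphisms take all their values in \<open>carr Y\<close>,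
  also at arguments outside \<open>carr X\<close>, so linearity of the action is available everywhere it is needed.
\<close>

lemma subspace_Hom:
  assumes X: "fd_rmod sc X" and Y: "fd_rmod sc Y"
  shows "hv.subspace (Hom X Y)"
proof (rule hv.subspaceI)
  note sX = fd_rmod_subspace[OF X] and sY = fd_rmod_subspace[OF Y]
  have actX: "act X x b \<in> carr X" if "x \<in> carr X" for x b using that X by (simp add: fd_rmod_def)
  show "0 \<in> Hom X Y"
    using kv.subspace_0[OF sY] act_zero[OF Y] by (auto simp: Hom_def lin_maps_def)
  fix f assume f: "f \<in> Hom X Y"
  {
    fix g assume g: "g \<in> Hom X Y"
    have "act Y (f x + g x) b = act Y (f x) b + act Y (g x) b" for x b
      using Y Hom_in_carr[OF Y f, of x] Hom_in_carr[OF Y g, of x] unfolding fd_rmod_def by blast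
    then show "f + g \<in> Hom X Y"
      using Hom_lin[OF f] Hom_lin[OF g]
      by (auto simp: Hom_def lin_maps_def algebra_simps kv.scale_right_distrib
          intro!: kv.subspace_add[OF sY])
  }
  fix c
  have "act Y (vscale c (f x)) b = vscale c (act Y (f x) b)" for x b
    using Y Hom_in_carr[OF Y f, of x] unfolding fd_rmod_def by blast
  then show "hscale c f \<in> Hom X Y"
    using Hom_lin[OF f]
    by (auto simp: Hom_def lin_maps_def hscale_def kv.scale_right_distrib mult.commute
        intro!: kv.subspace_scale[OF sY])
qed

lemma sum_fun_apply: "(\<Sum>i\<in>I. F i) x = (\<Sum>i\<in>I. F i x)"
  for F :: "'i \<Rightarrow> 'a \<Rightarrow> 'b::comm_monoid_add"
  by (induction I rule: infinite_finite_induct) auto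

text \<open>
  Bases of both modules give matrix units \<open>e i j\<close>, and a homomorphism is the combination of them with its
  matrix entries as coefficients.  The matrix units are linear maps but no homomorphisms in general, so they
  span a larger space.
\<close>

lemma fd_Hom:
  assumes X: "fd_rmod sc X" and Y: "fd_rmod sc Y"
  shows "hv.fd_subspace (Hom X Y)"
proof -
  obtain xs where xs: "kv.ordered_basis xs (carr X)"
    using kv.ordered_basis_exists X unfolding fd_rmod_def by metis
  obtain ys where ys: "kv.ordered_basis ys (carr Y)"
    using kv.ordered_basis_exists Y unfolding fd_rmod_def by metis
  interpret X: based_space vscale xs "carr X" by unfold_locales (rule xs)
  interpret Y: based_space vscale ys "carr Y" by unfold_locales (rule ys)
  define e where "e i j = (\<lambda>v. if v \<in> carr X then vscale (X.coord v i) (ys ! j) else 0)" for i j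
  define S where "S = (\<lambda>(i, j). e i j) ` ({..<length xs} \<times> {..<length ys})"
  have "f \<in> hv.span S" if f: "f \<in> Hom X Y" for f
  proof -
    have "f = (\<Sum>i<length xs. \<Sum>j<length ys. hscale (Y.coord (f (xs ! i)) j) (e i j))"
    proof (rule ext)
      fix v
      show "f v = (\<Sum>i<length xs. \<Sum>j<length ys. hscale (Y.coord (f (xs ! i)) j) (e i j)) v"
      proof (cases "v \<in> carr X")
        case False
        then show ?thesis using Hom_lin(1)[OF f] by (simp add: sum_fun_apply hscale_def e_def)
      next
        case True
        have "f v = (\<Sum>i<length xs. vscale (X.coord v i) (f (xs ! i)))"
          using kv_hom.additive_lincomb[OF X.subspace_V Hom_lin(3,4)[OF f],
              of "{..<length xs}" "(!) xs" "X.coord v"] X.basis_nth X.sum_coord[OF True] by simp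
        also have "\<dots> = (\<Sum>i<length xs. vscale (X.coord v i)
            (\<Sum>j<length ys. vscale (Y.coord (f (xs ! i)) j) (ys ! j)))"
          using Y.sum_coord[OF Hom_in_carr[OF Y f]] by simp
        finally show ?thesis
          using True by (simp add: sum_fun_apply hscale_def e_def kv.scale_sum_right mult.commute)
      qed
    qed
    also have "\<dots> \<in> hv.span S"
      unfolding S_def
      by (intro hv.span_sum hv.span_scale hv.span_base) auto
    finally show ?thesis .
  qed
  moreover have "finite S" by (simp add: S_def)
  ultimately show ?thesis
    by (intro hv.fd_subspace_if_subset_span[OF subspace_Hom[OF X Y]]) auto
qed

lemma Hom_comp:
  assumes "fd_rmod sc X" "fd_rmod sc Y" "fd_rmod sc Z" "f \<in> Hom Y Z" "g \<in> Hom X Y"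
  shows "f \<circ> g \<in> Hom X Z"
  using Hom_lin[OF assms(4)] Hom_lin[OF assms(5)] Hom_0[OF assms(2,4)]
  by (auto simp: Hom_def lin_maps_def)

lemma id_map_in_End:
  assumes "fd_rmod sc X"
  shows "id_map (carr X) \<in> End X"
proof -
  note s = fd_rmod_subspace[OF assms]
  have "act X x b \<in> carr X" if "x \<in> carr X" for x b using that assms by (simp add: fd_rmod_def)
  then show ?thesis
    using kv.subspace_add[OF s] kv.subspace_scale[OF s]
    by (auto simp: Hom_def lin_maps_def id_map_def)
qed

lemma id_map_comp:
  assumes "fd_rmod sc Y" "f \<in> Hom X Y"
  shows "id_map (carr Y) \<circ> f = f"
  using Hom_in_carr[OF assms] by (auto simp: id_map_def)

lemma comp_id_map:
  assumes "fd_rmod sc X" "f \<in> Hom X Y"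
  shows "f \<circ> id_map (carr X) = f"
  using Hom_0[OF assms] Hom_lin(1)[OF assms(2)] by (auto simp: id_map_def)

section \<open>Direct sums of modules\<close>

lemma component_add: "component j (v + w) = component j v + component j w"
  by (simp add: component_def fun_eq_iff)

lemma component_vscale: "component j (vscale c v) = vscale c (component j v)"
  by (simp add: component_def vscale_def)

lemma component_zero: "component j 0 = 0"
  by (simp add: component_def fun_eq_iff)

lemma component_act_dsum:
  "component j (act (dsum Xs) v b) = (if j < length Xs then act (Xs ! j) (component j v) b else 0)"
  by (auto simp: component_def dsum_def fun_eq_iff)

lemma component_eqI: "(\<And>j. component j v = component j w) \<Longrightarrow> v = w"
  by (rule ext) (metis component_def prod_decode_inverse surj_pair)

lemma carr_dsum:
  "v \<in> carr (dsum Xs) \<longleftrightarrow> (\<forall>j<length Xs. component j v \<in> carr (Xs ! j)) \<and>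
     (\<forall>j\<ge>length Xs. component j v = 0)"
  by (simp add: dsum_def)

text \<open>
  The inclusion of the \<open>j\<close>-th summand into a direct sum, with the same pairing of indices.
\<close>

definition summand_incl :: "nat \<Rightarrow> 'k::zero kvec \<Rightarrow> 'k kvec" where
  "summand_incl j v = (\<lambda>n. case prod_decode n of (j', i) \<Rightarrow> if j' = j then v i else 0)"

lemma component_summand_incl: "component j' (summand_incl j v) = (if j' = j then v else 0)"
  by (auto simp: component_def summand_incl_def)

text \<open>
  The images of finite spanning sets of the summands under the inclusions span the direct sum.
\<close>

lemma fd_dsum:
  assumes Xs: "\<forall>X\<in>set Xs. kv.fd_subspace (carr X)"
  shows "kv.fd_subspace (carr (dsum Xs))"
proof -
  let ?C = "carr (dsum Xs)"
  have X: "kv.subspace (carr (Xs ! j))" if "j < length Xs" for j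
    using Xs that by (intro kv.subspace_if_fd) auto
  have "\<exists>S. finite S \<and> kv.span S = carr (Xs ! j)" if "j < length Xs" for j
    using Xs that by (auto simp: kv.fd_subspace_def)
  then obtain S where S: "finite (S j)" "kv.span (S j) = carr (Xs ! j)" if "j < length Xs" for j
    by metis
  define U where "U = (\<Union>j<length Xs. summand_incl j ` S j)"
  have incl: "summand_incl j v \<in> kv.span U" if j: "j < length Xs" and v: "v \<in> carr (Xs ! j)" for j v
  proof -
    define T where "T = {v. summand_incl j v \<in> kv.span U}"
    have "summand_incl j (v + w) = summand_incl j v + summand_incl j w" for v w :: "'a kvec"
      by (auto simp: summand_incl_def fun_eq_iff split: prod.split)
    moreover have "summand_incl j (vscale c v) = vscale c (summand_incl j v)" for c and v :: "'a kvec"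
      by (auto simp: summand_incl_def vscale_def fun_eq_iff split: prod.split)
    moreover have "summand_incl j (0 :: 'a kvec) = 0"
      by (auto simp: summand_incl_def fun_eq_iff split: prod.split)
    ultimately have "kv.subspace T"
      by (intro kv.subspaceI) (auto simp: T_def kv.span_zero kv.span_add kv.span_scale)
    moreover have "S j \<subseteq> T" using j by (auto simp: T_def U_def intro!: kv.span_base)
    ultimately have "kv.span (S j) \<subseteq> T" by (intro kv.span_minimal)
    then show ?thesis using S(2)[OF j] v by (auto simp: T_def)
  qed
  have "v \<in> kv.span U" if v: "v \<in> ?C" for v
  proof -
    have csum: "component j (\<Sum>i\<in>I. F i) = (\<Sum>i\<in>I. component j (F i))" for j I and F :: "nat \<Rightarrow> 'a kvec"
      using sum_comp_morphism[of "component j" F I, OF component_zero component_add]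
      by (simp add: o_def)
    have "v = (\<Sum>j<length Xs. summand_incl j (component j v))"
    proof (rule component_eqI)
      fix j
      show "component j v = component j (\<Sum>j<length Xs. summand_incl j (component j v))"
        using v by (cases "j < length Xs") (simp_all add: csum component_summand_incl carr_dsum)
    qed
    also have "\<dots> \<in> kv.span U"
      using v by (intro kv.span_sum incl) (auto simp: carr_dsum)
    finally show ?thesis .
  qed
  moreover have "finite U" using S(1) by (auto simp: U_def)
  moreover have "kv.subspace ?C"
    using X kv.subspace_0[OF X] kv.subspace_add[OF X] kv.subspace_scale[OF X]
    by (intro kv.subspaceI) (auto simp: carr_dsum component_zero component_add component_vscale)
  ultimately show ?thesis by (intro kv.fd_subspace_if_subset_span) auto
qed

lemma fd_rmod_dsum:
  assumes "\<forall>X\<in>set Xs. fd_rmod sc X"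
  shows "fd_rmod sc (dsum Xs)"
  unfolding fd_rmod_def
proof (intro conjI ballI allI)
  note c = component_add component_vscale component_zero component_act_dsum
  have X: "fd_rmod sc (Xs ! j)" if "j < length Xs" for j using assms that by auto
  show "kv.fd_subspace (carr (dsum Xs))" using assms by (intro fd_dsum) (auto simp: fd_rmod_def)
  fix x assume "x \<in> carr (dsum Xs)"
  then have x: "\<And>j. j < length Xs \<Longrightarrow> component j x \<in> carr (Xs ! j)"
    and x': "\<And>j. j \<ge> length Xs \<Longrightarrow> component j x = 0"
    by (auto simp: carr_dsum)
  note D = fd_rmodD[OF X]
  show "act (dsum Xs) x b \<in> carr (dsum Xs)" for b
    by (simp add: carr_dsum c D(2) x)
  show "act (dsum Xs) x 1 = x"
    by (rule component_eqI) (simp add: c D(3) x x')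
  show "act (dsum Xs) x (a * b) = act (dsum Xs) (act (dsum Xs) x a) b" for a b
    by (rule component_eqI) (simp add: c D(4) x)
  show "act (dsum Xs) x (a + b) = act (dsum Xs) x a + act (dsum Xs) x b" for a b
    by (rule component_eqI) (simp add: component_add component_act_dsum D(6) x)
  show "act (dsum Xs) (vscale r x) b = vscale r (act (dsum Xs) x b)" for b r
    by (rule component_eqI) (simp add: c D(7) x)
  show "act (dsum Xs) x (sc r b) = vscale r (act (dsum Xs) x b)" for b r
    by (rule component_eqI) (simp add: c D(8) x)
  fix y b assume "y \<in> carr (dsum Xs)"
  then have y: "\<And>j. j < length Xs \<Longrightarrow> component j y \<in> carr (Xs ! j)"
    by (auto simp: carr_dsum)
  show "act (dsum Xs) (x + y) b = act (dsum Xs) x b + act (dsum Xs) y b"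
    by (rule component_eqI) (simp add: component_add component_act_dsum D(5) x y)
qed

lemma carr_dsum_nonzero:
  assumes Xs: "\<forall>X\<in>set Xs. fd_rmod sc X" and X: "X \<in> set Xs" "carr X \<noteq> {0}"
  shows "carr (dsum Xs) \<noteq> {0}"
proof -
  obtain j where j: "j < length Xs" "X = Xs ! j" using X(1) by (auto simp: in_set_conv_nth)
  have "0 \<in> carr (Xs ! i)" if "i < length Xs" for i using Xs that fd_rmod_zero[of sc "Xs ! i"] by simp
  moreover obtain v where v: "v \<in> carr X" "v \<noteq> 0" using X Xs fd_rmod_zero[of sc X] by blast
  ultimately have "summand_incl j v \<in> carr (dsum Xs)"
    using j by (auto simp: carr_dsum component_summand_incl)
  moreover have "summand_incl j v \<noteq> 0"
    using v(2) component_summand_incl[of j j v] component_zero[of j] by metis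
  ultimately show ?thesis by blast
qed

section \<open>Isomorphisms and stabilisers\<close>

definition isos :: "('k::field, 'b) rmod \<Rightarrow> ('k, 'b) rmod \<Rightarrow> ('k kvec \<Rightarrow> 'k kvec) set" where
  "isos X Y = {f \<in> Hom X Y. bij_betw f (carr X) (carr Y)}"

lemma isos_comp:
  assumes "fd_rmod sc X" "fd_rmod sc Y" "fd_rmod sc Z" "f \<in> isos Y Z" "g \<in> isos X Y"
  shows "f \<circ> g \<in> isos X Z"
  using assms Hom_comp bij_betw_trans unfolding isos_def by blast

lemma isos_inverse:
  assumes X: "fd_rmod sc X" and f: "f \<in> isos X Y"
  obtains g where "g \<in> isos Y X" "g \<circ> f = id_map (carr X)" "f \<circ> g = id_map (carr Y)"
proof -
  define g where "g = (\<lambda>y. if y \<in> carr Y then the_inv_into (carr X) f y else 0)"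
  note lin = Hom_lin[of f X Y]
  have fH: "f \<in> Hom X Y" and b: "bij_betw f (carr X) (carr Y)" using f by (auto simp: isos_def)
  have inj: "inj_on f (carr X)" and im: "f ` carr X = carr Y" using b by (auto simp: bij_betw_def)
  have gf: "g (f x) = x" if "x \<in> carr X" for x
    using that inj im by (auto simp: g_def the_inv_into_f_f)
  have sX: "kv.subspace (carr X)" by (rule fd_rmod_subspace[OF X])
  have actX: "act X x b \<in> carr X" if "x \<in> carr X" for x b using that X by (simp add: fd_rmod_def)
  have g0: "g y = 0" if "y \<notin> carr Y" for y using that by (simp add: g_def)
  have add: "g (f x + f y) = x + y" if "x \<in> carr X" "y \<in> carr X" for x y
    using gf[of "x + y"] lin(3)[OF fH that] kv.subspace_add[OF sX that] by simp
  have scale: "g (vscale c (f x)) = vscale c x" if "x \<in> carr X" for x c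
    using gf[of "vscale c x"] lin(4)[OF fH that] kv.subspace_scale[OF sX that] by simp
  have act: "g (act Y (f x) b) = act X x b" if "x \<in> carr X" for x b
    using gf[of "act X x b"] lin(5)[OF fH that] actX[OF that] by simp
  have gH: "g \<in> Hom Y X"
    using g0 gf add scale act by (simp add: Hom_def lin_maps_def im[symmetric])
  have "g ` carr Y = carr X" unfolding im[symmetric] image_image using gf by auto
  moreover have "inj_on g (carr Y)" unfolding im[symmetric] by (rule inj_onI) (use gf in auto)
  ultimately have "g \<in> isos Y X" using gH by (simp add: isos_def bij_betw_def)
  moreover have "g \<circ> f = id_map (carr X)"
    using gf gf[OF fd_rmod_zero[OF X]] Hom_lin(1)[OF fH] Hom_0[OF X fH]
    by (intro ext) (auto simp: id_map_def)
  moreover have "f \<circ> g = id_map (carr Y)"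
  proof (rule ext)
    fix y
    show "(f \<circ> g) y = id_map (carr Y) y"
    proof (cases "y \<in> carr Y")
      case True
      then obtain x where "x \<in> carr X" "y = f x" using im by blast
      then show ?thesis using gf True by (simp add: id_map_def)
    next
      case False
      then show ?thesis using Hom_0[OF X fH] by (simp add: g_def id_map_def)
    qed
  qed
  ultimately show ?thesis by (rule that)
qed

lemma push_comp: "push (f \<circ> g) L = push f (push g L)"
  by (auto simp: push_def image_image comp_assoc)

lemma push_id_map:
  assumes "fd_rmod sc Y" "L \<subseteq> Hom E Y"
  shows "push (id_map (carr Y)) L = L"
proof -
  have "id_map (carr Y) \<circ> \<phi> = \<phi>" if "\<phi> \<in> L" for \<phi>
    using id_map_comp[OF assms(1), of \<phi> E] assms(2) that by blast
  then show ?thesis unfolding push_def by simp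
qed

definition scalars :: "('k::field, 'b) rmod \<Rightarrow> ('k kvec \<Rightarrow> 'k kvec) set" where
  "scalars N = {hscale c (id_map (carr N)) | c. True}"

lemma scalars_subset_Stab:
  assumes N: "fd_rmod sc N" and L: "hv.subspace L" "L \<subseteq> Hom E N"
  shows "scalars N \<subseteq> Stab N L"
proof -
  have "hscale c (id_map (carr N)) \<circ> \<phi> = hscale c \<phi>" if "\<phi> \<in> L" for c \<phi>
  proof -
    have "hscale c (id_map (carr N)) \<circ> \<phi> = hscale c (id_map (carr N) \<circ> \<phi>)"
      by (simp add: hscale_def comp_def)
    then show ?thesis using id_map_comp[OF N, of \<phi> E] that L(2) by auto
  qed
  then show ?thesis
    using hv.subspace_scale[OF L(1)] hv.subspace_scale[OF subspace_Hom[OF N N] id_map_in_End[OF N]]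
    by (auto simp: scalars_def Stab_def push_def)
qed

lemma push_linear_endo:
  assumes E: "fd_rmod sc E" and N: "fd_rmod sc N" and f: "f \<in> End N"
  shows "hv.linear_endo (Hom E N) (\<lambda>\<phi>. f \<circ> \<phi>)"
proof -
  have "f (\<phi> x + \<psi> x) = f (\<phi> x) + f (\<psi> x)" "f (vscale r (\<phi> x)) = vscale r (f (\<phi> x))"
    if "\<phi> \<in> Hom E N" "\<psi> \<in> Hom E N" for \<phi> \<psi> x r
    using Hom_lin(3,4)[OF f] Hom_in_carr[OF N] that by blast+
  then show ?thesis
    using Hom_comp[OF E N N f] by (auto simp: hv.linear_endo_def hscale_def fun_eq_iff)
qed

text \<open>
  Completing the identity to a basis of \<open>End N\<close>: the coefficient of the identity does not matter for
  stability of a subspace, so the stabiliser is reduced to the scalars exactly when no nontrivial combination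
  of the remaining basis elements stabilises it.
\<close>

lemma brick_locus_no_stable_combination:
  assumes E: "fd_rmod sc E" and N: "fd_rmod sc N" and nz: "carr N \<noteq> {0}"
  obtains s fs where "hv.dim (End N) = Suc s" "\<And>k. k < s \<Longrightarrow> fs k \<in> End N"
    "brick_locus E N l =
      {L \<in> hv.grassmannian (Hom E N) l. hv.no_stable_combination s (\<lambda>k \<phi>. fs k \<circ> \<phi>) L}"
proof -
  let ?id = "id_map (carr N)"
  obtain v where v: "v \<in> carr N" "v \<noteq> 0" using nz fd_rmod_zero[OF N] by blast
  then have id0: "?id \<noteq> 0" by (auto simp: id_map_def fun_eq_iff)
  obtain T where T: "hv.ordered_basis ([?id] @ T) (End N)"
  proof (rule hv.ordered_basis_extending[OF fd_Hom[OF N N], of "[?id]"])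
    show "hv.independent (set [?id])"
      using id0 hv.dependent_single[of ?id] by simp
  qed (use id_map_in_End[OF N] in auto)
  interpret R: based_space hscale "?id # T" "End N" by unfold_locales (use T in simp)
  define s where "s = length T"
  have TE: "T ! k \<in> End N" if "k < s" for k using R.basis_nth[of "Suc k"] that by (simp add: s_def)
  have dim: "hv.dim (End N) = Suc s" using R.length_basis by (simp add: s_def)
  have split: "f = hscale (R.coord f 0) ?id + (\<Sum>k<s. hscale (R.coord f (Suc k)) (T ! k))"
    if "f \<in> End N" for f
    using R.sum_coord[OF that]
    by (simp add: s_def sum.lessThan_Suc_shift del: sum.lessThan_Suc)
  have unique: "a k = 0" if 0: "(\<Sum>k<s. hscale (a k) (T ! k)) = hscale c ?id" and k: "k < s" for a c k
  proof -
    define r where "r j = (if j = 0 then - c else a (j - 1))" for j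
    have "(\<Sum>j<length (?id # T). hscale (r j) ((?id # T) ! j)) = 0"
      using 0 by (simp add: r_def s_def sum.lessThan_Suc_shift del: sum.lessThan_Suc)
    then show ?thesis using R.coord_row_vec[of "Suc k" r] k by (simp add: R.coord_zero r_def s_def)
  qed
  have comb: "(\<Sum>k<s. hscale (a k) (T ! k \<circ> \<phi>)) = (\<Sum>k<s. hscale (a k) (T ! k)) \<circ> \<phi>" for a \<phi>
    by (simp add: fun_eq_iff sum_fun_apply hscale_def)
  have combE: "(\<Sum>k<s. hscale (a k) (T ! k)) \<in> End N" for a
    using TE by (intro hv.subspace_sum[OF R.subspace_V] hv.subspace_scale[OF R.subspace_V]) auto
  have iff: "Stab N L = scalars N \<longleftrightarrow> hv.no_stable_combination s (\<lambda>k \<phi>. T ! k \<circ> \<phi>) L"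
    if L: "L \<in> hv.grassmannian (Hom E N) l" for L
  proof
    have sL: "hv.subspace L" and LH: "L \<subseteq> Hom E N"
      using L by (auto simp: hv.grassmannian_def intro: hv.subspace_if_fd)
    {
      assume S: "Stab N L = scalars N"
      show "hv.no_stable_combination s (\<lambda>k \<phi>. T ! k \<circ> \<phi>) L"
        unfolding hv.no_stable_combination_def comb
      proof (intro allI impI)
        fix a k assume "\<forall>\<phi>\<in>L. (\<Sum>k<s. hscale (a k) (T ! k)) \<circ> \<phi> \<in> L" "k < s"
        then have "(\<Sum>k<s. hscale (a k) (T ! k)) \<in> scalars N"
          using combE[of a] unfolding S[symmetric] by (auto simp: Stab_def push_def)
        then obtain c where "(\<Sum>k<s. hscale (a k) (T ! k)) = hscale c ?id"
          unfolding scalars_def by blast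
        then show "a k = 0" using \<open>k < s\<close> by (rule unique)
      qed
    }
    assume n: "hv.no_stable_combination s (\<lambda>k \<phi>. T ! k \<circ> \<phi>) L"
    have "f \<in> scalars N" if f: "f \<in> Stab N L" for f
    proof -
      have fE: "f \<in> End N" and fL: "\<And>\<phi>. \<phi> \<in> L \<Longrightarrow> f \<circ> \<phi> \<in> L"
        using f by (auto simp: Stab_def push_def)
      define c where "c = R.coord f 0"
      define g where "g = (\<Sum>k<s. hscale (R.coord f (Suc k)) (T ! k))"
      have fg: "f = hscale c ?id + g" unfolding c_def g_def by (rule split[OF fE])
      have "g \<circ> \<phi> \<in> L" if "\<phi> \<in> L" for \<phi>
      proof -
        have "?id \<circ> \<phi> = \<phi>" using id_map_comp[OF N, of \<phi> E] that LH by blast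
        then have "?id (\<phi> v) = \<phi> v" for v by (metis comp_apply)
        then have "g \<circ> \<phi> = (f \<circ> \<phi>) - hscale c \<phi>" 
          by (intro ext) (simp add: fg hscale_def)
        also have "\<dots> \<in> L"
          by (intro hv.subspace_diff[OF sL] hv.subspace_scale[OF sL] fL that)
        finally show ?thesis .
      qed
      then have 0: "\<forall>k<s. R.coord f (Suc k) = 0"
        using n[unfolded hv.no_stable_combination_def comb, THEN spec, of "\<lambda>k. R.coord f (Suc k)"]
        by (simp add: g_def)
      have "g = 0" unfolding g_def by (intro sum.neutral) (simp add: 0)
      then have "f = hscale c ?id" using fg by (metis add.right_neutral)
      then show ?thesis by (auto simp: scalars_def)
    qed
    then show "Stab N L = scalars N" using scalars_subset_Stab[OF N sL LH] by blast
  qed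
  have "brick_locus E N l =
      {L \<in> hv.grassmannian (Hom E N) l. hv.no_stable_combination s (\<lambda>k \<phi>. T ! k \<circ> \<phi>) L}"
    unfolding brick_locus_def scalars_def[symmetric] using iff by blast
  from that[OF dim TE this] show ?thesis .
qed

section \<open>Modules over the one-point extension\<close>

lemma kvec_subspace_of_dim:
  obtains W :: "'k::field kvec set" where "kv.fd_subspace W" "kv.dim W = l"
proof -
  define e :: "nat \<Rightarrow> 'k kvec" where "e i = (\<lambda>n. if n = i then 1 else 0)" for i
  have inj: "inj_on e {..<l}"
    by (rule inj_onI) (metis e_def zero_neq_one)
  have ind: "kv.independent (e ` {..<l})"
  proof (rule kv.independent_if_scalars_zero)
    fix u x assume 0: "(\<Sum>x\<in>e ` {..<l}. vscale (u x) x) = 0" and "x \<in> e ` {..<l}"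
    then obtain i where i: "i < l" "x = e i" by auto
    have "0 = (\<Sum>x\<in>e ` {..<l}. vscale (u x) x) i" using 0 by simp
    also have "\<dots> = (\<Sum>j<l. u (e j) * e j i)"
      using inj by (simp add: sum.reindex sum_fun_apply vscale_def)
    also have "\<dots> = (\<Sum>j<l. if j = i then u (e j) else 0)"
      by (intro sum.cong) (auto simp: e_def)
    also have "\<dots> = u x" using i by simp
    finally show "u x = 0" by simp
  qed simp
  show ?thesis
  proof (rule that)
    show "kv.fd_subspace (kv.span (e ` {..<l}))" unfolding kv.fd_subspace_def by blast
    show "kv.dim (kv.span (e ` {..<l})) = l"
      using kv.dim_span_eq_card_independent[OF ind] card_image[OF inj] by simp
  qed
qed

lemma lin_maps_lin:
  assumes "f \<in> lin_maps s t V W"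
  shows "x \<notin> V \<Longrightarrow> f x = 0" and "x \<in> V \<Longrightarrow> f x \<in> W"
    and "x \<in> V \<Longrightarrow> y \<in> V \<Longrightarrow> f (x + y) = f x + f y" and "x \<in> V \<Longrightarrow> f (s c x) = t c (f x)"
  using assms by (auto simp: lin_maps_def)

text \<open>
  A subspace of \<open>Hom E N\<close> becomes a module over the one-point extension by choosing a space \<open>W\<close> of the
  same dimension and an isomorphism; matching two bases provides it.
\<close>

lemma parametrization_exists:
  assumes W: "kv.fd_subspace W" and L: "hv.fd_subspace L" and dim: "kv.dim W = hv.dim L"
  obtains \<eta> where "\<eta> \<in> lin_maps vscale hscale W L" "inj_on \<eta> W" "\<eta> ` W = L"
proof -
  obtain ws where ws: "kv.ordered_basis ws W" "length ws = kv.dim W"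
    using kv.ordered_basis_exists[OF W] .
  obtain ls where ls: "hv.ordered_basis ls L" "length ls = hv.dim L"
    using hv.ordered_basis_exists[OF L] .
  interpret W: based_space vscale ws W by unfold_locales (rule ws)
  interpret L: based_space hscale ls L by unfold_locales (rule ls)
  have len: "length ws = length ls" using ws ls dim by simp
  define \<eta> where "\<eta> = (\<lambda>w. if w \<in> W then \<Sum>j<length ls. hscale (W.coord w j) (ls ! j) else 0)"
  have "\<eta> \<in> lin_maps vscale hscale W L"
    unfolding lin_maps_def mem_Collect_eq
  proof (intro conjI allI ballI impI)
    show "\<eta> x = 0" if "x \<notin> W" for x using that by (simp add: \<eta>_def)
    fix x assume x: "x \<in> W"
    have "(\<Sum>j<length ls. hscale (W.coord x j) (ls ! j)) \<in> L"
      using L.basis_nth by (intro hv.subspace_sum[OF L.subspace_V] hv.subspace_scale[OF L.subspace_V]) auto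
    then show "\<eta> x \<in> L" using x by (simp add: \<eta>_def)
    show "\<eta> (x + y) = \<eta> x + \<eta> y" if y: "y \<in> W" for y
      using kv.subspace_add[OF W.subspace_V x y] x y
      by (simp add: \<eta>_def W.coord_add hv.scale_left_distrib sum.distrib del: plus_fun_def)
    show "\<eta> (vscale c x) = hscale c (\<eta> x)" for c
      using kv.subspace_scale[OF W.subspace_V x, of c] x
      by (simp add: \<eta>_def W.coord_scale hv.scale_sum_right)
  qed
  moreover have "inj_on \<eta> W"
  proof (rule inj_onI)
    fix x y assume xy: "x \<in> W" "y \<in> W" "\<eta> x = \<eta> y"
    have "W.coord x j = W.coord y j" if "j < length ws" for j
      using L.coord_row_vec[of j "W.coord x"] L.coord_row_vec[of j "W.coord y"] xy that len
      by (simp add: \<eta>_def)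
    then show "x = y" using W.coord_eqI xy(1,2) by blast
  qed
  moreover have "v \<in> \<eta> ` W" if v: "v \<in> L" for v
  proof -
    let ?w = "\<Sum>j<length ws. vscale (L.coord v j) (ws ! j)"
    have w: "?w \<in> W"
      using W.basis_nth by (intro kv.subspace_sum[OF W.subspace_V] kv.subspace_scale[OF W.subspace_V]) auto
    have "\<eta> ?w = (\<Sum>j<length ls. hscale (W.coord ?w j) (ls ! j))" using w by (simp add: \<eta>_def)
    also have "\<dots> = (\<Sum>j<length ls. hscale (L.coord v j) (ls ! j))"
    proof (rule sum.cong)
      fix j assume "j \<in> {..<length ls}"
      then have "W.coord ?w j = L.coord v j"
        by (intro W.coord_row_vec) (simp add: len)
      then show "hscale (W.coord ?w j) (ls ! j) = hscale (L.coord v j) (ls ! j)"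
        by (rule arg_cong)
    qed simp
    also have "\<dots> = v" by (rule L.sum_coord[OF v])
    finally have "v = \<eta> ?w" by (rule sym)
    then show ?thesis using w by (rule image_eqI)
  qed
  moreover have "\<eta> ` W \<subseteq> L" using calculation(1) by (auto simp: lin_maps_def)
  ultimately show ?thesis by (intro that[of \<eta>]) auto
qed

locale opext =
  fixes sc :: "'k::field \<Rightarrow> 'b::ring_1 \<Rightarrow> 'b" and E :: "('k, 'b) rmod"
  assumes E: "fd_rmod sc E"
begin

lemma opext_modD:
  assumes "M \<in> opext_mod sc E"
  shows "fd_rmod sc (base M)" "kv.fd_subspace (vtx M)" "kv.subspace (vtx M)"
    "str M \<in> lin_maps vscale hscale (vtx M) (Hom E (base M))"
    "str M ` vtx M \<subseteq> Hom E (base M)"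
  using assms by (auto simp: opext_mod_def lin_maps_def intro: kv.subspace_if_fd)

lemma str_image:
  assumes M: "M \<in> opext_mod sc E" and inj: "inj_on (str M) (vtx M)"
  shows "str M ` vtx M \<in> hv.grassmannian (Hom E (base M)) (kv.dim (vtx M))"
  using kv_hv.fd_subspace_injective_image[OF opext_modD(2)[OF M] inj
      lin_maps_lin(3,4)[OF opext_modD(4)[OF M]]] opext_modD(5)[OF M]
  by (auto simp: hv.grassmannian_def)

lemma triple_Hom_push:
  assumes "(f, g) \<in> triple_Hom M M'"
  shows "push f (str M ` vtx M) \<subseteq> str M' ` vtx M'"
  using assms by (auto simp: triple_Hom_def push_def lin_maps_def)

lemma Hom_comp_add:
  assumes "fd_rmod sc X" "f \<in> Hom X Y" "\<phi> \<in> Hom E X" "\<psi> \<in> Hom E X"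
  shows "f \<circ> (\<phi> + \<psi>) = (f \<circ> \<phi>) + (f \<circ> \<psi>)" and "f \<circ> hscale c \<phi> = hscale c (f \<circ> \<phi>)"
  using Hom_lin(3,4)[OF assms(2)] Hom_in_carr[OF assms(1)] assms(3,4)
  by (auto simp: hscale_def)

text \<open>
  When the target structure map is injective, a module homomorphism \<open>f\<close> that respects the images of the
  structure maps has a companion \<open>g\<close>: lift composition with \<open>f\<close> through the injective structure map.
\<close>

lemma triple_Hom_lift:
  assumes M: "M \<in> opext_mod sc E" and M': "M' \<in> opext_mod sc E"
    and inj: "inj_on (str M') (vtx M')" and f: "f \<in> Hom (base M) (base M')"
    and sub: "push f (str M ` vtx M) \<subseteq> str M' ` vtx M'"
  obtains g where "(f, g) \<in> triple_Hom M M'"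
proof -
  note D = opext_modD[OF M] and D' = opext_modD[OF M']
  note l = lin_maps_lin[OF D(4)] and l' = lin_maps_lin[OF D'(4)]
  define g where "g w = (if w \<in> vtx M then the_inv_into (vtx M') (str M') (f \<circ> str M w) else 0)" for w
  have fw: "f \<circ> str M w \<in> str M' ` vtx M'" if "w \<in> vtx M" for w
    using sub that by (auto simp: push_def)
  have gW: "g w \<in> vtx M'" if "w \<in> vtx M" for w
    using the_inv_into_into[OF inj fw[OF that] subset_refl] that by (simp add: g_def)
  have g: "str M' (g w) = f \<circ> str M w" if "w \<in> vtx M" for w
    using f_the_inv_into_f[OF inj fw[OF that]] that by (simp add: g_def)
  have "g (x + y) = g x + g y" if xy: "x \<in> vtx M" "y \<in> vtx M" for x y
  proof (rule inj_onD[OF inj])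
    have xy': "x + y \<in> vtx M" using kv.subspace_add[OF D(3) xy] .
    show "g (x + y) \<in> vtx M'" "g x + g y \<in> vtx M'"
      using gW xy xy' kv.subspace_add[OF D'(3)] by auto
    have "str M' (g (x + y)) = f \<circ> (str M x + str M y)" using g[OF xy'] l(3)[OF xy] by simp
    also have "\<dots> = str M' (g x) + str M' (g y)"
      unfolding Hom_comp_add(1)[OF D(1) f l(2)[OF xy(1)] l(2)[OF xy(2)]] g[OF xy(1)] g[OF xy(2)] ..
    also have "\<dots> = str M' (g x + g y)" using l'(3)[OF gW gW] xy by simp
    finally show "str M' (g (x + y)) = str M' (g x + g y)" .
  qed
  moreover have "g (vscale c x) = vscale c (g x)" if x: "x \<in> vtx M" for c x
  proof (rule inj_onD[OF inj])
    have cx: "vscale c x \<in> vtx M" using kv.subspace_scale[OF D(3) x] .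
    show "g (vscale c x) \<in> vtx M'" "vscale c (g x) \<in> vtx M'"
      using gW x cx kv.subspace_scale[OF D'(3)] by auto
    have "str M' (g (vscale c x)) = f \<circ> hscale c (str M x)" using g[OF cx] l(4)[OF x] by simp
    also have "\<dots> = hscale c (str M' (g x))"
      unfolding Hom_comp_add(2)[OF D(1) f l(2)[OF x] l(2)[OF x]] g[OF x] ..
    also have "\<dots> = str M' (vscale c (g x))" using l'(4)[OF gW[OF x]] by simp
    finally show "str M' (g (vscale c x)) = str M' (vscale c (g x))" .
  qed
  ultimately have "g \<in> lin_maps vscale vscale (vtx M) (vtx M')"
    using gW by (auto simp: lin_maps_def g_def)
  then show ?thesis using f g by (intro that[of g]) (auto simp: triple_Hom_def)
qed

lemma scalar_triple_Hom:
  assumes M: "M \<in> opext_mod sc E"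
  shows "(hscale c (id_map (carr (base M))), hscale c (id_map (vtx M))) \<in> triple_Hom M M"
proof -
  note D = opext_modD[OF M]
  note l = lin_maps_lin[OF D(4)]
  have "hscale c (id_map (vtx M)) \<in> lin_maps vscale vscale (vtx M) (vtx M)"
    using kv.subspace_add[OF D(3)] kv.subspace_scale[OF D(3)]
    by (auto simp: lin_maps_def hscale_def id_map_def kv.scale_right_distrib mult.commute)
  moreover have "hscale c (id_map (carr (base M))) \<circ> str M w = str M (hscale c (id_map (vtx M)) w)"
    if w: "w \<in> vtx M" for w
  proof -
    have "hscale c (id_map (carr (base M))) \<circ> str M w = hscale c (id_map (carr (base M)) \<circ> str M w)"
      by (simp add: hscale_def comp_def)
    also have "\<dots> = str M (vscale c w)" using id_map_comp[OF D(1) l(2)[OF w]] l(4)[OF w] by simp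
    also have "vscale c w = hscale c (id_map (vtx M)) w" using w by (simp add: hscale_def id_map_def)
    finally show ?thesis .
  qed
  ultimately show ?thesis
    using hv.subspace_scale[OF subspace_Hom[OF D(1) D(1)] id_map_in_End[OF D(1)]]
    by (auto simp: triple_Hom_def)
qed

lemma hscale_id_map_eq_0:
  assumes "0 = hscale c (id_map V)" "V \<noteq> {0}" "0 \<in> V"
  shows "c = 0"
proof -
  obtain v where v: "v \<in> V" "v \<noteq> 0" using assms(2,3) by blast
  then have "vscale c v = 0" using fun_cong[OF assms(1), of v] by (simp add: hscale_def id_map_def)
  then show ?thesis using v by simp
qed

text \<open>
  If \<open>w0\<close> is a nonzero vector in the kernel of the structure map, project \<open>vtx M\<close> onto the line of \<open>w0\<close>.
  Together with the zero map on the base this is an endomorphism, so it is a scalar; the scalar is \<open>0\<close> as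
  the base is nonzero, but the projection is not.
\<close>

lemma mixed_brick_inj:
  assumes M: "M \<in> mixed_bricks sc E"
  shows "inj_on (str M) (vtx M)"
proof (rule inj_onI, rule ccontr)
  fix x y assume xy: "x \<in> vtx M" "y \<in> vtx M" "str M x = str M y" "x \<noteq> y"
  have Mo: "M \<in> opext_mod sc E" and br: "is_brick M" and nz: "carr (base M) \<noteq> {0}"
    using M by (auto simp: mixed_bricks_def)
  note D = opext_modD[OF Mo]
  note l = lin_maps_lin[OF D(4)]
  define w0 where "w0 = x - y"
  have w0: "w0 \<in> vtx M" "w0 \<noteq> 0" using xy kv.subspace_diff[OF D(3)] by (auto simp: w0_def)
  have "str M w0 + str M y = str M x" using l(3)[OF w0(1) xy(2)] by (simp add: w0_def)
  then have s0: "str M w0 = 0" using xy(3) by (metis add_cancel_left_left)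
  obtain T where T: "kv.ordered_basis ([w0] @ T) (vtx M)"
    by (rule kv.ordered_basis_extending[OF D(2), of "[w0]"]) (use w0 in auto)
  interpret W: based_space vscale "w0 # T" "vtx M" by unfold_locales (use T in simp)
  define g where "g w = (if w \<in> vtx M then vscale (W.coord w 0) w0 else 0)" for w
  have "g \<in> lin_maps vscale vscale (vtx M) (vtx M)"
    using kv.subspace_add[OF D(3)] kv.subspace_scale[OF D(3)] w0(1)
    by (auto simp: lin_maps_def g_def W.coord_add W.coord_scale kv.scale_left_distrib)
  moreover have "str M (g w) = 0" if "w \<in> vtx M" for w
    using that l(4)[OF w0(1)] by (simp add: g_def s0)
  ultimately have "(0, g) \<in> triple_Hom M M"
    using hv.subspace_0[OF subspace_Hom[OF D(1) D(1)]]
    by (auto simp: triple_Hom_def fun_eq_iff)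
  then obtain c where c: "0 = hscale c (id_map (carr (base M)))" "g = hscale c (id_map (vtx M))"
    using br unfolding is_brick_def by blast
  have "c = 0" by (rule hscale_id_map_eq_0[OF c(1) nz fd_rmod_zero[OF D(1)]])
  then have "g w0 = 0" using c(2) by simp
  moreover have "g w0 = w0" using w0(1) W.coord_basis[of 0 0] by (simp add: g_def)
  ultimately show False using w0(2) by simp
qed

text \<open>
  Sending \<open>(f, g)\<close> to \<open>f\<close> identifies the endomorphisms of \<open>M\<close> with the stabiliser of the image of the
  structure map: \<open>g\<close> is determined by \<open>f\<close> because the structure map is injective, and it exists by lifting.
\<close>

lemma is_brick_iff_Stab:
  assumes M: "M \<in> opext_mod sc E" and inj: "inj_on (str M) (vtx M)" and nz: "carr (base M) \<noteq> {0}"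
  shows "is_brick M \<longleftrightarrow> Stab (base M) (str M ` vtx M) = scalars (base M)"
proof
  note D = opext_modD[OF M]
  note l = lin_maps_lin[OF D(4)]
  have L: "hv.subspace (str M ` vtx M)"
    using str_image[OF M inj] by (auto simp: hv.grassmannian_def intro: hv.subspace_if_fd)
  {
    assume br: "is_brick M"
    have "f \<in> scalars (base M)" if f: "f \<in> Stab (base M) (str M ` vtx M)" for f
    proof -
      obtain g where "(f, g) \<in> triple_Hom M M"
        using triple_Hom_lift[OF M M inj, of f] f unfolding Stab_def by blast
      then show ?thesis using br unfolding is_brick_def scalars_def by blast
    qed
    then show "Stab (base M) (str M ` vtx M) = scalars (base M)"
      using scalars_subset_Stab[OF D(1) L D(5)] by blast
  }
  assume S: "Stab (base M) (str M ` vtx M) = scalars (base M)"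
  have "\<exists>c. fg = (hscale c (id_map (carr (base M))), hscale c (id_map (vtx M)))"
    if fg: "fg \<in> triple_Hom M M" for fg
  proof -
    obtain f g where fg_eq: "fg = (f, g)" by (cases fg)
    have h: "(f, g) \<in> triple_Hom M M" using fg fg_eq by simp
    then have "f \<in> Stab (base M) (str M ` vtx M)"
      using triple_Hom_push[OF h] by (auto simp: Stab_def triple_Hom_def)
    then obtain c where c: "f = hscale c (id_map (carr (base M)))"
      using S by (auto simp: scalars_def)
    have gl: "g \<in> lin_maps vscale vscale (vtx M) (vtx M)"
      and fs: "\<And>w. w \<in> vtx M \<Longrightarrow> f \<circ> str M w = str M (g w)"
      using h by (auto simp: triple_Hom_def)
    have "g w = hscale c (id_map (vtx M)) w" for w
    proof (cases "w \<in> vtx M")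
      case True
      have "hscale c (id_map (vtx M)) w = vscale c w" using True by (simp add: hscale_def id_map_def)
      moreover have "str M (g w) = str M (hscale c (id_map (vtx M)) w)"
        using fs[OF True] scalar_triple_Hom[OF M, of c] True by (simp add: triple_Hom_def c)
      ultimately show ?thesis
        using inj_onD[OF inj] lin_maps_lin(2)[OF gl True] kv.subspace_scale[OF D(3) True] by metis
    next
      case False
      then show ?thesis using lin_maps_lin(1)[OF gl] by (simp add: hscale_def id_map_def)
    qed
    then show ?thesis using c fg_eq by blast
  qed
  then show "is_brick M"
    using nz scalar_triple_Hom[OF M] unfolding is_brick_def by blast
qed

section \<open>Orbits of subspaces and isomorphism classes of bricks\<close>

text \<open>
  All transports of a subspace of \<open>Hom E X\<close> to \<open>Hom E N\<close>.  For \<open>X = N\<close> this is the orbit under the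
  automorphism group; for \<open>X\<close> isomorphic to \<open>N\<close> it is the orbit of any one transport.
\<close>

definition iso_orbit :: "('k, 'b) rmod \<Rightarrow> ('k, 'b) rmod \<Rightarrow> ('k kvec \<Rightarrow> 'k kvec) set \<Rightarrow>
    ('k kvec \<Rightarrow> 'k kvec) set set" where
  "iso_orbit X N L = {push \<phi> L | \<phi>. \<phi> \<in> isos X N}"

lemma iso_orbit_push:
  assumes X: "fd_rmod sc X" and Y: "fd_rmod sc Y" and N: "fd_rmod sc N"
    and f: "f \<in> isos X Y" and L: "L \<subseteq> Hom E X"
  shows "iso_orbit Y N (push f L) = iso_orbit X N L"
proof (intro equalityI subsetI)
  fix K assume "K \<in> iso_orbit Y N (push f L)"
  then obtain \<phi> where "\<phi> \<in> isos Y N" "K = push (\<phi> \<circ> f) L" by (auto simp: iso_orbit_def push_comp)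
  then show "K \<in> iso_orbit X N L" using isos_comp[OF X Y N _ f] by (auto simp: iso_orbit_def)
next
  fix K assume "K \<in> iso_orbit X N L"
  then obtain \<phi> where \<phi>: "\<phi> \<in> isos X N" "K = push \<phi> L" by (auto simp: iso_orbit_def)
  obtain g where g: "g \<in> isos Y X" "g \<circ> f = id_map (carr X)" by (rule isos_inverse[OF X f])
  have "push (\<phi> \<circ> g) (push f L) = push \<phi> (push (g \<circ> f) L)" by (simp add: push_comp)
  then have "K = push (\<phi> \<circ> g) (push f L)" using \<phi>(2) g(2) push_id_map[OF X L] by simp
  then show "K \<in> iso_orbit Y N (push f L)"
    using isos_comp[OF Y X N \<phi>(1) g(1)] by (auto simp: iso_orbit_def)
qed

lemma aut_orbits_eq: "aut_orbits N \<L> = iso_orbit N N ` \<L>"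
  by (simp add: aut_orbits_def iso_orbit_def[abs_def] Aut_def isos_def)

lemma push_mem_grassmannian:
  assumes X: "fd_rmod sc X" and N: "fd_rmod sc N" and f: "f \<in> isos X N"
    and L: "L \<in> hv.grassmannian (Hom E X) l"
  shows "push f L \<in> hv.grassmannian (Hom E N) l"
proof -
  have fH: "f \<in> Hom X N" using f by (simp add: isos_def)
  have Lf: "hv.fd_subspace L" and LH: "L \<subseteq> Hom E X" and d: "hv.dim L = l"
    using L by (auto simp: hv.grassmannian_def)
  obtain g where g: "g \<in> isos N X" "g \<circ> f = id_map (carr X)" by (rule isos_inverse[OF X f])
  have "inj_on (\<lambda>\<phi>. f \<circ> \<phi>) L"
  proof (rule inj_on_inverseI[of _ "\<lambda>\<phi>. g \<circ> \<phi>"])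
    fix \<phi> assume "\<phi> \<in> L"
    then show "g \<circ> (f \<circ> \<phi>) = \<phi>" using id_map_comp[OF X, of \<phi> E] LH g(2) by (auto simp flip: comp_assoc)
  qed
  moreover have "f \<circ> (\<phi> + \<psi>) = (f \<circ> \<phi>) + (f \<circ> \<psi>)" if "\<phi> \<in> L" "\<psi> \<in> L" for \<phi> \<psi>
    by (rule Hom_comp_add(1)[OF X fH]) (use that LH in blast)+
  moreover have "f \<circ> hscale c \<phi> = hscale c (f \<circ> \<phi>)" if "\<phi> \<in> L" for c \<phi>
    by (rule Hom_comp_add(2)[OF X fH]) (use that LH in blast)+
  ultimately have "hv.fd_subspace ((\<lambda>\<phi>. f \<circ> \<phi>) ` L)" "hv.dim ((\<lambda>\<phi>. f \<circ> \<phi>) ` L) = hv.dim L"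
    using hv_hom.fd_subspace_injective_image[OF Lf] by blast+
  moreover have "push f L \<subseteq> Hom E N" using Hom_comp[OF E X N fH] LH by (auto simp: push_def)
  ultimately show ?thesis using d by (simp add: hv.grassmannian_def push_def)
qed

text \<open>
  Conjugation with \<open>f\<close> carries the stabiliser of \<open>push f L\<close> back to that of \<open>L\<close> and preserves scalars.
\<close>

lemma brick_locus_push:
  assumes X: "fd_rmod sc X" and N: "fd_rmod sc N" and f: "f \<in> isos X N"
    and L: "L \<in> brick_locus E X l"
  shows "push f L \<in> brick_locus E N l"
proof -
  have LG: "L \<in> hv.grassmannian (Hom E X) l" and S: "Stab X L = scalars X"
    using L by (auto simp: brick_locus_def scalars_def)
  have LH: "L \<subseteq> Hom E X" using LG by (simp add: hv.grassmannian_def)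
  have fG: "push f L \<in> hv.grassmannian (Hom E N) l" by (rule push_mem_grassmannian[OF X N f LG])
  have fH: "f \<in> Hom X N" using f by (simp add: isos_def)
  obtain g where g: "g \<in> isos N X" "g \<circ> f = id_map (carr X)" "f \<circ> g = id_map (carr N)"
    by (rule isos_inverse[OF X f])
  have gH: "g \<in> Hom N X" using g(1) by (simp add: isos_def)
  have "h \<in> scalars N" if h: "h \<in> Stab N (push f L)" for h
  proof -
    have hE: "h \<in> End N" and hL: "push h (push f L) \<subseteq> push f L" using h by (auto simp: Stab_def)
    have "push (g \<circ> h \<circ> f) L = push g (push h (push f L))" by (simp add: push_comp)
    also have "\<dots> \<subseteq> push g (push f L)" using hL by (auto simp: push_def)
    also have "\<dots> = L" using push_id_map[OF X LH] g(2) by (simp flip: push_comp)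
    finally have "g \<circ> h \<circ> f \<in> Stab X L"
      using Hom_comp[OF X N X Hom_comp[OF N N X gH hE] fH] by (simp add: Stab_def)
    then obtain c where c: "g \<circ> h \<circ> f = hscale c (id_map (carr X))"
      using S by (auto simp: scalars_def)
    have "h = (f \<circ> g) \<circ> h \<circ> (f \<circ> g)"
      using id_map_comp[OF N hE] comp_id_map[OF N hE] g(3) by simp
    also have "\<dots> = f \<circ> (g \<circ> h \<circ> f) \<circ> g" by (simp add: comp_assoc)
    also have "\<dots> = f \<circ> hscale c (id_map (carr X)) \<circ> g" by (simp add: c)
    also have "\<dots> = hscale c (f \<circ> (id_map (carr X) \<circ> g))"
    proof (rule ext)
      fix v
      have "id_map (carr X) (g v) \<in> carr X"
        using Hom_in_carr[OF X gH, of v] by (simp add: id_map_def)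
      then show "(f \<circ> hscale c (id_map (carr X)) \<circ> g) v = hscale c (f \<circ> (id_map (carr X) \<circ> g)) v"
        using Hom_lin(4)[OF fH] by (simp add: hscale_def)
    qed
    also have "\<dots> = hscale c (id_map (carr N))" using id_map_comp[OF X gH] g(3) by simp
    finally show ?thesis by (auto simp: scalars_def)
  qed
  moreover have "scalars N \<subseteq> Stab N (push f L)"
    using fG by (intro scalars_subset_Stab[OF N]) (auto simp: hv.grassmannian_def intro: hv.subspace_if_fd)
  ultimately show ?thesis using fG unfolding brick_locus_def scalars_def[symmetric] by blast
qed

text \<open>
  An isomorphism of triples maps one image of the structure map onto the other, which does not change the
  set of transports to \<open>N\<close>.  Conversely, a common element \<open>push \<phi> (\<dots>) = push \<psi> (\<dots>)\<close> of the two sets gives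
  the isomorphism of bases \<open>f = \<psi>\<inverse> \<circ> \<phi>\<close> that matches the images, and \<open>f\<close> lifts to the other component.
\<close>

lemma triple_iso_iff_iso_orbit_eq:
  assumes M: "M \<in> opext_mod sc E" "inj_on (str M) (vtx M)"
    and M': "M' \<in> opext_mod sc E" "inj_on (str M') (vtx M')"
    and N: "fd_rmod sc N" and iso: "rmod_iso (base M) N" 
  shows "triple_iso M M' \<longleftrightarrow>
    iso_orbit (base M) N (str M ` vtx M) = iso_orbit (base M') N (str M' ` vtx M')"
proof
  note D = opext_modD[OF M(1)] and D' = opext_modD[OF M'(1)]
  {
    assume "triple_iso M M'"
    then obtain f g where h: "(f, g) \<in> triple_Hom M M'"
      and f: "bij_betw f (carr (base M)) (carr (base M'))" and g: "bij_betw g (vtx M) (vtx M')"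
      by (auto simp: triple_iso_def)
    have "push f (str M ` vtx M) = (\<lambda>w. str M' (g w)) ` vtx M"
      using h by (auto simp: push_def image_image triple_Hom_def)
    also have "\<dots> = str M' ` vtx M'"
      using g by (simp add: bij_betw_def flip: image_image)
    finally have "push f (str M ` vtx M) = str M' ` vtx M'" .
    moreover have "f \<in> isos (base M) (base M')" using h f by (simp add: isos_def triple_Hom_def)
    ultimately show "iso_orbit (base M) N (str M ` vtx M) = iso_orbit (base M') N (str M' ` vtx M')"
      using iso_orbit_push[OF D(1) D'(1) N _ D(5)] by metis
  }
  assume eq: "iso_orbit (base M) N (str M ` vtx M) = iso_orbit (base M') N (str M' ` vtx M')"
  obtain \<phi> where \<phi>: "\<phi> \<in> isos (base M) N" using iso by (auto simp: rmod_iso_def isos_def)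
  then have "push \<phi> (str M ` vtx M) \<in> iso_orbit (base M') N (str M' ` vtx M')"
    unfolding eq[symmetric] by (auto simp: iso_orbit_def)
  then obtain \<psi> where \<psi>: "\<psi> \<in> isos (base M') N"
    "push \<phi> (str M ` vtx M) = push \<psi> (str M' ` vtx M')" by (auto simp: iso_orbit_def)
  obtain \<chi> where \<chi>: "\<chi> \<in> isos N (base M')" "\<chi> \<circ> \<psi> = id_map (carr (base M'))"
    by (rule isos_inverse[OF D'(1) \<psi>(1)])
  define f where "f = \<chi> \<circ> \<phi>"
  have fI: "f \<in> isos (base M) (base M')" unfolding f_def by (rule isos_comp[OF D(1) N D'(1) \<chi>(1) \<phi>])
  have fH: "f \<in> Hom (base M) (base M')" using fI by (simp add: isos_def)
  have fL: "push f (str M ` vtx M) = str M' ` vtx M'"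
    using \<psi>(2) \<chi>(2) push_id_map[OF D'(1) D'(5)] by (simp add: f_def push_comp flip: push_comp[of \<chi> \<psi>])
  obtain g where h: "(f, g) \<in> triple_Hom M M'"
    using triple_Hom_lift[OF M(1) M'(1,2) fH] fL by auto
  have gl: "g \<in> lin_maps vscale vscale (vtx M) (vtx M')"
    and fs: "\<And>w. w \<in> vtx M \<Longrightarrow> f \<circ> str M w = str M' (g w)"
    using h by (auto simp: triple_Hom_def)
  have gW: "g w \<in> vtx M'" if "w \<in> vtx M" for w using lin_maps_lin(2)[OF gl that] .
  obtain f' where f': "f' \<circ> f = id_map (carr (base M))" by (rule isos_inverse[OF D(1) fI])
  have "inj_on g (vtx M)"
  proof (rule inj_onI)
    fix x y assume xy: "x \<in> vtx M" "y \<in> vtx M" "g x = g y"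
    then have "f \<circ> str M x = f \<circ> str M y" using fs by simp
    then have "(f' \<circ> f) \<circ> str M x = (f' \<circ> f) \<circ> str M y" by (simp add: comp_assoc)
    then have "str M x = str M y"
      using id_map_comp[OF D(1) lin_maps_lin(2)[OF D(4)]] xy(1,2) f' by simp
    then show "x = y" using inj_onD[OF M(2)] xy(1,2) by blast
  qed
  moreover have "g ` vtx M = vtx M'"
  proof (intro equalityI subsetI)
    fix w' assume w': "w' \<in> vtx M'"
    then obtain w where w: "w \<in> vtx M" "str M' w' = f \<circ> str M w"
      using fL by (auto simp: push_def image_image)
    then have "w' = g w" using fs inj_onD[OF M'(2)] gW w' by metis
    then show "w' \<in> g ` vtx M" using w(1) by blast
  qed (use gW in auto)
  ultimately show "triple_iso M M'"
    using h fI unfolding triple_iso_def by (auto simp: bij_betw_def isos_def)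
qed

end

lemma bij_betw_quotient:
  assumes "\<And>x y. x \<in> A \<Longrightarrow> y \<in> A \<Longrightarrow> R x y \<longleftrightarrow> g x = g y"
  shows "bij_betw (\<lambda>C. the_elem (g ` C)) (A // {(x, y). x \<in> A \<and> y \<in> A \<and> R x y}) (g ` A)"
proof -
  let ?r = "{(x, y). x \<in> A \<and> y \<in> A \<and> R x y}"
  have cl: "?r `` {x} = {y\<in>A. g y = g x}" if "x \<in> A" for x using assms that by auto
  have val: "the_elem (g ` (?r `` {x})) = g x" if "x \<in> A" for x
  proof -
    have "g ` (?r `` {x}) = {g x}" unfolding cl[OF that] using that by auto
    then show ?thesis by simp
  qed
  show ?thesis
    unfolding bij_betw_def
  proof
    show "inj_on (\<lambda>C. the_elem (g ` C)) (A // ?r)"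
    proof (rule inj_onI)
      fix C D assume "C \<in> A // ?r" "D \<in> A // ?r" and eq: "the_elem (g ` C) = the_elem (g ` D)"
      then obtain x y where x: "x \<in> A" "C = ?r `` {x}" and y: "y \<in> A" "D = ?r `` {y}"
        by (auto elim!: quotientE)
      have "g x = g y" using eq unfolding x(2) y(2) val[OF x(1)] val[OF y(1)] .
      then show "C = D" unfolding x(2) y(2) cl[OF x(1)] cl[OF y(1)] by simp
    qed
    have "A // ?r = (\<lambda>x. ?r `` {x}) ` A" by (auto simp: quotient_def)
    then show "(\<lambda>C. the_elem (g ` C)) ` (A // ?r) = g ` A"
      using val by (simp add: image_image)
  qed
qed

text \<open>
  The class of \<open>M\<close> goes to the set of all transports of the image of its structure map.  This is an orbit in
  the brick locus by \<open>is_brick_iff_Stab\<close> and \<open>brick_locus_push\<close>; conversely a subspace in the locus is itself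
  the image of the structure map of a brick with base \<open>N\<close>.
\<close>

lemma (in opext) brick_classes_bij_orbits:
  assumes N: "fd_rmod sc N" and nz: "carr N \<noteq> {0}" and l: "1 \<le> l"
  shows "\<exists>\<Phi>. bij_betw \<Phi>
    (triple_iso_classes {M \<in> mixed_bricks sc E. rmod_iso (base M) N \<and> kv.dim (vtx M) = l})
    (aut_orbits N (brick_locus E N l))"
proof -
  define \<M> where "\<M> = {M \<in> mixed_bricks sc E. rmod_iso (base M) N \<and> kv.dim (vtx M) = l}"
  define orb where "orb M = iso_orbit (base M) N (str M ` vtx M)" for M :: "('k, 'b) triple"
  have M: "M \<in> opext_mod sc E" "inj_on (str M) (vtx M)" "rmod_iso (base M) N" "is_brick M"
    "carr (base M) \<noteq> {0}" "kv.dim (vtx M) = l" if "M \<in> \<M>" for M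
    using that mixed_brick_inj by (auto simp: \<M>_def mixed_bricks_def)
  have "bij_betw (\<lambda>C. the_elem (orb ` C)) (triple_iso_classes \<M>) (orb ` \<M>)"
    unfolding triple_iso_classes_def orb_def
    by (intro bij_betw_quotient triple_iso_iff_iso_orbit_eq M N) assumption+
  moreover have "orb ` \<M> = aut_orbits N (brick_locus E N l)"
  proof (intro equalityI subsetI)
    fix K assume "K \<in> orb ` \<M>"
    then obtain M where MM: "M \<in> \<M>" and K: "K = orb M" by blast
    note M = M[OF MM]
    note D = opext_modD[OF M(1)]
    obtain \<phi> where \<phi>: "\<phi> \<in> isos (base M) N" using M(3) by (auto simp: rmod_iso_def isos_def)
    have "str M ` vtx M \<in> brick_locus E (base M) l"
      using str_image[OF M(1,2)] M(4,6) is_brick_iff_Stab[OF M(1,2,5)]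
      by (simp add: brick_locus_def scalars_def)
    then have "push \<phi> (str M ` vtx M) \<in> brick_locus E N l" by (rule brick_locus_push[OF D(1) N \<phi>])
    moreover have "K = iso_orbit N N (push \<phi> (str M ` vtx M))"
      using iso_orbit_push[OF D(1) N N \<phi> D(5)] by (simp add: K orb_def)
    ultimately show "K \<in> aut_orbits N (brick_locus E N l)" by (auto simp: aut_orbits_eq)
  next
    fix K assume "K \<in> aut_orbits N (brick_locus E N l)"
    then obtain L where L: "L \<in> brick_locus E N l" and K: "K = iso_orbit N N L"
      by (auto simp: aut_orbits_eq)
    have S: "Stab N L = scalars N" and Lf: "hv.fd_subspace L" "L \<subseteq> Hom E N" "hv.dim L = l"
      using L by (auto simp: brick_locus_def scalars_def hv.grassmannian_def)
    obtain W :: "'k kvec set" where W: "kv.fd_subspace W" "kv.dim W = l"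
      by (rule kvec_subspace_of_dim)
    obtain \<eta> where \<eta>: "\<eta> \<in> lin_maps vscale hscale W L" "inj_on \<eta> W" "\<eta> ` W = L"
      using parametrization_exists[OF W(1) Lf(1)] W(2) Lf(3) by metis
    define M :: "('k, 'b) triple" where "M = \<lparr>base = N, vtx = W, str = \<eta>\<rparr>"
    have sel: "base M = N" "vtx M = W" "str M = \<eta>" by (simp_all add: M_def)
    have Mo: "M \<in> opext_mod sc E"
      using N W(1) \<eta>(1) Lf(2) by (auto simp: opext_mod_def sel lin_maps_def)
    have "kv.dim {0 :: 'k kvec} = 0"
      using kv.dim_span_eq_card_independent[OF kv.independent_empty] by simp
    then have "W \<noteq> {0}" using W(2) l by auto
    moreover have "is_brick M" using is_brick_iff_Stab[OF Mo] \<eta>(2,3) nz S by (simp add: sel)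
    moreover have "rmod_iso N N"
      using id_map_in_End[OF N] unfolding rmod_iso_def
      by (intro bexI[of _ "id_map (carr N)"]) (auto simp: id_map_def bij_betw_def inj_on_def)
    ultimately have "M \<in> \<M>" using Mo nz W(2) by (simp add: \<M>_def mixed_bricks_def sel)
    moreover have "K = orb M" by (simp add: K orb_def sel \<eta>(3))
    ultimately show "K \<in> orb ` \<M>" by blast
  qed
  ultimately show ?thesis unfolding \<M>_def by metis
qed

theorem theorem2:
  fixes scaleB :: "'k::alg_closed_field \<Rightarrow> 'b::ring_1 \<Rightarrow> 'b"
    and E :: "('k, 'b) rmod" and Xs :: "('k, 'b) rmod list"
    and m :: "nat list" and l :: nat
  assumes "fd_algebra scaleB"
    and "fd_rmod scaleB E"
    and "visible_finite scaleB E"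
    and "visible_representatives scaleB E Xs"
    and "length m = length Xs"
    and "\<exists>i<length m. m ! i \<noteq> 0"
    and "1 \<le> l" and "l \<le> h_dim E Xs m"
  shows
    "(brick_locus E (mult_sum Xs m) l \<noteq> {} \<longrightarrow>
        int (r_dim Xs m) - 1 \<le> int l * (int (h_dim E Xs m) - int l)) \<and>
     openin (hv.zariski (Hom E (mult_sum Xs m)) l) (brick_locus E (mult_sum Xs m) l) \<and>
     (\<exists>\<Phi>. bij_betw \<Phi>
        (triple_iso_classes {M \<in> mixed_bricks scaleB E.
           rmod_iso (base M) (mult_sum Xs m) \<and> kv.dim (vtx M) = l})
        (aut_orbits (mult_sum Xs m) (brick_locus E (mult_sum Xs m) l)))"
proof -
  let ?N = "mult_sum Xs m" and ?Ys = "concat (map2 replicate m Xs)"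
  interpret opext scaleB E by unfold_locales fact
  have Xs: "fd_rmod scaleB X" "carr X \<noteq> {0}" if "X \<in> set Xs" for X
    using assms(4) that
    by (auto simp: visible_representatives_def visible_indecs_def indecomposable_def)
  have Ys: "\<forall>X\<in>set ?Ys. fd_rmod scaleB X"
    using Xs(1) by (auto dest: set_zip_rightD)
  obtain i where i: "i < length m" "m ! i \<noteq> 0" using assms(6) by blast
  have "(m ! i, Xs ! i) \<in> set (zip m Xs)" using i(1) assms(5) by (metis length_zip min.idem nth_mem nth_zip)
  then have "Xs ! i \<in> set ?Ys" using i(2) by force
  then have nz: "carr ?N \<noteq> {0}"
    unfolding mult_sum_def using carr_dsum_nonzero[OF Ys] Xs(2)[of "Xs ! i"] i(1) assms(5) by simp
  have N: "fd_rmod scaleB ?N" unfolding mult_sum_def by (rule fd_rmod_dsum[OF Ys])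
  obtain s fs where r: "hv.dim (End ?N) = Suc s" and fs: "\<And>k. k < s \<Longrightarrow> fs k \<in> End ?N"
    and B: "brick_locus E ?N l =
      {L \<in> hv.grassmannian (Hom E ?N) l. hv.no_stable_combination s (\<lambda>k \<phi>. fs k \<circ> \<phi>) L}"
    by (rule brick_locus_no_stable_combination[OF assms(2) N nz, where l = l]) (rule that)
  have endo: "hv.linear_endo (Hom E ?N) (\<lambda>\<phi>. fs k \<circ> \<phi>)" if "k < s" for k
    by (rule push_linear_endo[OF assms(2) N fs[OF that]])
  have l: "l \<le> hv.dim (Hom E ?N)" using assms(8) by (simp add: h_dim_def)
  obtain bs where bs: "hv.ordered_basis bs (Hom E ?N)"
    using hv.ordered_basis_exists[OF fd_Hom[OF assms(2) N]] .
  interpret V: based_space hscale bs "Hom E ?N" by unfold_locales (rule bs)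
  have "int (r_dim Xs m) - 1 \<le> int l * (int (h_dim E Xs m) - int l)"
    if ne: "brick_locus E ?N l \<noteq> {}"
  proof -
    obtain L where L: "L \<in> hv.grassmannian (Hom E ?N) l"
      "hv.no_stable_combination s (\<lambda>k \<phi>. fs k \<circ> \<phi>) L" using ne unfolding B by blast
    have "s \<le> l * (hv.dim (Hom E ?N) - l)"
      by (rule V.dim_le_if_no_stable_combination[OF L(1) endo L(2)])
    then have "int s \<le> int (l * (hv.dim (Hom E ?N) - l))" by (simp only: zle_int)
    then show ?thesis using l by (simp add: r_dim_def h_dim_def r of_nat_diff)
  qed
  moreover have "openin (hv.zariski (Hom E ?N) l) (brick_locus E ?N l)"
    unfolding B by (rule hv.openin_zariski_no_stable_combination[OF l endo])
  ultimately show ?thesis using brick_classes_bij_orbits[OF N nz assms(7)] by blast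
qed

end
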